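(* Let $n\in\mathbb{N}$ and $N=p_1^{k_1}\cdots p_r^{k_r}$ with distinct primes $p_1,\dots,p_r$ and $k_1,\dots,k_r\in\mathbb{N}$. Any Kakeya set $S\subseteq(\mathbb{Z}/N\mathbb{Z})^n$ satisfies $$|S|\ \ge\ \Bigl(\prod_{i=1}^r\bigl(2(k_i+\lceil\log_{p_i}(n)\rceil)\bigr)^{-n}\Bigr)\cdot N^n.$$ Moreover, when $p_1,\dots,p_r\ge n$, any Kakeya set $S\subseteq(\mathbb{Z}/N\mathbb{Z})^n$ satisfies $$|S|\ \ge\ N^n\prod_{i=1}^r (k_i+1)^{-n}(1+n/p_i)^{-n}.$$
   Context: For $N=p_1^{k_1}\cdots p_r^{k_r}$ (distinct primes $p_i$), the projective space $\mathbb{P}(\mathbb{Z}/N\mathbb{Z})^{n-1}$ is the set of vectors $u\in(\mathbb{Z}/N\mathbb{Z})^n$ such that for every $i$, $u\bmod p_i^{k_i}$ has at least one unit coordinate, taken up to multiplication by units of $\mathbb{Z}/N\mathbb{Z}$ (its elements are called directions). A line in direction $u$ is a set $\{a+\lambda u:\lambda\in\mathbb{Z}/N\mathbb{Z}\}$ with $a\in(\mathbb{Z}/N\mathbb{Z})^n$. A Kakeya set is a set $S\subseteq(\mathbb{Z}/N\mathbb{Z})^n$ which contains a line in every direction $u\in\mathbb{P}(\mathbb{Z}/N\mathbb{Z})^{n-1}$. *)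

theory Defs
  imports Complex_Main "HOL-Library.FuncSet" "HOL-Number_Theory.Number_Theory"
begin

text \<open>
  The ring of integers modulo \<open>N\<close> is represented by the residues \<open>{0..<N}\<close> with arithmetic modulo
  \<open>N\<close>, and vectors over it by extensional functions on \<open>{..<n}\<close>, so that equality of vectors is
  equality of functions. The locale \<open>residues\<close> is avoided because it excludes \<open>N = 1\<close>; for the same
  reason a unit is required to have an inverse up to congruence, since \<open>1\<close> is not a residue
  modulo \<open>1\<close>.
\<close>

definition zmod :: "nat \<Rightarrow> int set" where
  "zmod N = {0..<int N}"

definition zmod_units :: "nat \<Rightarrow> int set" where
  "zmod_units N = {c \<in> zmod N. \<exists>d\<in>zmod N. [c * d = 1] (mod int N)}"

definition zmod_vecs :: "nat \<Rightarrow> nat \<Rightarrow> (nat \<Rightarrow> int) set" where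
  "zmod_vecs N n = {..<n} \<rightarrow>\<^sub>E zmod N"

definition vec_add :: "nat \<Rightarrow> nat \<Rightarrow> (nat \<Rightarrow> int) \<Rightarrow> (nat \<Rightarrow> int) \<Rightarrow> nat \<Rightarrow> int" where
  "vec_add N n a b = (\<lambda>j\<in>{..<n}. (a j + b j) mod int N)"

definition vec_smult :: "nat \<Rightarrow> nat \<Rightarrow> int \<Rightarrow> (nat \<Rightarrow> int) \<Rightarrow> nat \<Rightarrow> int" where
  "vec_smult N n c u = (\<lambda>j\<in>{..<n}. (c * u j) mod int N)"

text \<open>
  The prime powers occurring in the factorisation of \<open>N\<close> are \<open>p ^ multiplicity p N\<close>
  for \<open>p \<in> prime_factors N\<close>.
\<close>

definition direction_vecs :: "nat \<Rightarrow> nat \<Rightarrow> (nat \<Rightarrow> int) set" where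
  "direction_vecs N n = {u \<in> zmod_vecs N n. \<forall>p\<in>prime_factors N.
     \<exists>j<n. u j mod int (p ^ multiplicity p N) \<in> zmod_units (p ^ multiplicity p N)}"

definition unit_multiple_rel :: "nat \<Rightarrow> nat \<Rightarrow> ((nat \<Rightarrow> int) \<times> (nat \<Rightarrow> int)) set" where
  "unit_multiple_rel N n = {(u, v). u \<in> direction_vecs N n \<and> v \<in> direction_vecs N n \<and>
     (\<exists>c\<in>zmod_units N. v = vec_smult N n c u)}"

definition proj_space :: "nat \<Rightarrow> nat \<Rightarrow> (nat \<Rightarrow> int) set set" where
  "proj_space N n = direction_vecs N n // unit_multiple_rel N n"

definition line :: "nat \<Rightarrow> nat \<Rightarrow> (nat \<Rightarrow> int) \<Rightarrow> (nat \<Rightarrow> int) \<Rightarrow> (nat \<Rightarrow> int) set" where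
  "line N n a u = {vec_add N n a (vec_smult N n l u) | l. l \<in> zmod N}"

text \<open>
  A direction is a class of vectors; all its representatives give the same lines.
\<close>

definition line_in_direction ::
    "nat \<Rightarrow> nat \<Rightarrow> (nat \<Rightarrow> int) set \<Rightarrow> (nat \<Rightarrow> int) set \<Rightarrow> bool" where
  "line_in_direction N n D L \<longleftrightarrow> (\<exists>a\<in>zmod_vecs N n. \<exists>u\<in>D. L = line N n a u)"

definition kakeya_set :: "nat \<Rightarrow> nat \<Rightarrow> (nat \<Rightarrow> int) set \<Rightarrow> bool" where
  "kakeya_set N n S \<longleftrightarrow> S \<subseteq> zmod_vecs N n \<and>
     (\<forall>D\<in>proj_space N n. \<exists>L. line_in_direction N n D L \<and> L \<subseteq> S)"

end

theory Submission
  imports Defs "HOL-Computational_Algebra.Computational_Algebra" "HOL-Computational_Algebra.Field_as_Ring"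
begin

text \<open>
  Let \<open>N = q * M\<close> with \<open>q = p ^ k\<close> coprime to \<open>M\<close>, and let \<open>\<zeta>\<close> be a primitive complex \<open>q\<close>-th root of
  unity. A point \<open>s\<close> is sent to the node \<open>(\<zeta>^s\<^sub>0, \<dots>, \<zeta>^s\<^sub>n\<^sub>-\<^sub>1)\<close>, so that a line modulo \<open>q\<close> in direction
  \<open>u\<close> goes to the points \<open>w = \<zeta>^j\<close> of the curve \<open>w \<mapsto> (\<zeta>^a\<^sub>i * w^u\<^sub>i)\<^sub>i\<close>. A polynomial vanishing to order
  \<open>m\<close> at all nodes of the line restricts to a multiple of \<open>(w^q - 1)^m\<close> on the curve, and modulo the
  prime above \<open>p\<close>, where \<open>\<zeta>\<close> becomes \<open>1\<close>, to a multiple of \<open>(w - 1)^(q * m)\<close> on \<open>w \<mapsto> (w^u\<^sub>i)\<^sub>i\<close>.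

  For the directions \<open>(1, t\<^sub>1, \<dots>, t\<^sub>n\<^sub>-\<^sub>1)\<close> the polynomials
  \<open>(1 - z\<^sub>0)^t\<^sub>0 * (\<Prod>i\<ge>1. \<Prod>s<t\<^sub>i. z\<^sub>0^s - z\<^sub>i)\<close> form a triangular system: on the curve of \<open>t\<close> modulo
  \<open>p\<close>, the polynomial indexed by \<open>t'\<close> vanishes unless \<open>t'\<^sub>i \<le> t\<^sub>i\<close> for all \<open>i \<ge> 1\<close>, and for \<open>t' = t\<close> its
  order at \<open>w = 1\<close> is \<open>t\<^sub>0 + (\<Sum>i\<ge>1. \<Sum>j=1..t\<^sub>i. p^v(j))\<close> with \<open>v\<close> the \<open>p\<close>-adic valuation, which is less
  than \<open>q * m\<close> when \<open>t\<close> has small degree.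

  For several primes, the points \<open>x\<close> modulo \<open>M\<close> over which \<open>S\<close> contains a line modulo \<open>q\<close> in the
  direction of \<open>t\<close> form a Kakeya set \<open>U t\<close> modulo \<open>M\<close>. Giving each pair \<open>(t, x)\<close> with \<open>x \<in> U t\<close> its own
  unknown and applying the triangular system for each fixed \<open>x\<close> yields
  \<open>(\<Sum>t. card (U t)) \<le> card S * (m + n - 1 choose n)\<close>, and induction on the number of primes applies.
\<close>

section \<open>Linear algebra and congruences\<close>

lemma exists_nontrivial_solution:
  fixes f :: "'a \<Rightarrow> 'b \<Rightarrow> 'c::field"
  assumes "finite A" "finite B" "card A < card B"
  shows "\<exists>c. (\<exists>b\<in>B. c b \<noteq> 0) \<and> (\<forall>a\<in>A. (\<Sum>b\<in>B. f a b * c b) = 0)"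
  using assms
proof (induction A arbitrary: f B rule: finite_induct)
  case empty
  then have "B \<noteq> {}" by auto
  then show ?case by (intro exI[of _ "\<lambda>_. 1"]) auto
next
  case (insert a A)
  show ?case
  proof (cases "\<exists>b\<in>B. f a b \<noteq> 0")
    case False
    then have "(\<Sum>b\<in>B. f a b * c b) = 0" for c by (intro sum.neutral) auto
    with insert.IH[of B f] insert.prems insert.hyps show ?thesis by auto
  next
    case True
    then obtain b0 where b0: "b0 \<in> B" "f a b0 \<noteq> 0" by auto
    let ?g = "\<lambda>a' b. f a' b - f a' b0 * f a b / f a b0"
    have "card A < card (B - {b0})" using insert.prems insert.hyps b0 by simp
    then obtain c where c: "\<exists>b\<in>B - {b0}. c b \<noteq> 0"
      "\<And>a'. a' \<in> A \<Longrightarrow> (\<Sum>b\<in>B - {b0}. ?g a' b * c b) = 0"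
      using insert.IH[of "B - {b0}" ?g] insert.prems(1) by blast
    define s where "s = (\<Sum>b\<in>B - {b0}. f a b * c b)"
    define c' where "c' = c(b0 := - s / f a b0)"
    have split: "(\<Sum>b\<in>B. f a' b * c' b) = - f a' b0 * s / f a b0 + (\<Sum>b\<in>B - {b0}. f a' b * c b)" for a'
      using b0 insert.prems by (subst sum.remove[of _ b0]) (auto simp: c'_def intro!: sum.cong)
    have "(\<Sum>b\<in>B. f a' b * c' b) = 0" if "a' \<in> A" for a'
    proof -
      have "0 = (\<Sum>b\<in>B - {b0}. f a' b * c b - f a' b0 / f a b0 * (f a b * c b))"
        using c(2)[OF that] by (simp add: algebra_simps)
      also have "\<dots> = (\<Sum>b\<in>B - {b0}. f a' b * c b) - f a' b0 / f a b0 * s"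
        by (simp add: sum_subtractf sum_distrib_left s_def)
      finally show ?thesis unfolding split by (simp add: algebra_simps)
    qed
    moreover have "(\<Sum>b\<in>B. f a b * c' b) = 0"
      unfolding split using b0 by (simp add: s_def)
    moreover have "\<exists>b\<in>B. c' b \<noteq> 0" using c(1) by (auto simp: c'_def)
    ultimately show ?thesis by blast
  qed
qed

text \<open>
  The relation \<open>red x a\<close> stands for a ring homomorphism \<open>x \<mapsto> a mod p\<close> on a subring. Eliminating the
  row of least key multiplies the other rows by a pivot that is nonzero modulo \<open>p\<close>, so no inverses in
  the subring are needed.
\<close>

lemma triangular_kernel_trivial:
  fixes red :: "'a::field \<Rightarrow> int \<Rightarrow> bool" and key :: "'i \<Rightarrow> nat"
  assumes diff: "\<And>x y a b. red x a \<Longrightarrow> red y b \<Longrightarrow> red (x - y) (a - b)"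
    and mult: "\<And>x y a b. red x a \<Longrightarrow> red y b \<Longrightarrow> red (x * y) (a * b)"
    and zero: "\<And>a. red 0 a \<Longrightarrow> p dvd a"
    and "prime p" and "finite T"
    and "\<And>t s. t \<in> T \<Longrightarrow> s \<in> T \<Longrightarrow> red (X t s) (Y t s)"
    and "\<And>t. t \<in> T \<Longrightarrow> \<not> p dvd Y t t"
    and "\<And>t s. t \<in> T \<Longrightarrow> s \<in> T \<Longrightarrow> s \<noteq> t \<Longrightarrow> key t \<le> key s \<Longrightarrow> p dvd Y t s"
    and "\<And>t. t \<in> T \<Longrightarrow> (\<Sum>s\<in>T. X t s * c s) = 0"
  shows "\<forall>t\<in>T. c t = 0"
  using assms(5-)
proof (induction "card T" arbitrary: T X Y)
  case 0
  then show ?case by simp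
next
  case (Suc N)
  from Suc.hyps(2) have "T \<noteq> {}" by auto
  then obtain t where t: "t \<in> T" "\<And>s. s \<in> T \<Longrightarrow> key t \<le> key s"
    using ex_has_least_nat[of "\<lambda>x. x \<in> T" _ key] by blast
  define T' where "T' = T - {t}"
  have T'T: "s \<in> T' \<Longrightarrow> s \<in> T \<and> s \<noteq> t" for s by (auto simp: T'_def)
  define X' where "X' = (\<lambda>r s. X t t * X r s - X r t * X t s)"
  define Y' where "Y' = (\<lambda>r s. Y t t * Y r s - Y r t * Y t s)"
  \<comment> \<open>\<open>key t\<close> is least, so row \<open>t\<close> is zero modulo
    \<open>p\<close> off the diagonal. Modulo \<open>p\<close> the elimination therefore only scales
    the other rows by \<open>Y t t\<close>, which keeps the system triangular.\<close>
  have pt: "p dvd Y t s" if "s \<in> T'" for s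
    using Suc.prems(4)[OF t(1), of s] T'T[OF that] t(2) by auto
  have split: "(\<Sum>s\<in>T. X r s * c s) = X r t * c t + (\<Sum>s\<in>T'. X r s * c s)" for r
    unfolding T'_def using t(1) Suc.prems(1) by (rule sum.remove[rotated])
  have "\<forall>s\<in>T'. c s = 0"
  proof (rule Suc.hyps(1)[of T' X' Y'])
    show "N = card T'" using Suc.hyps(2) t(1) Suc.prems(1) by (simp add: T'_def)
    show "finite T'" using Suc.prems(1) by (simp add: T'_def)
    show "red (X' r s) (Y' r s)" if "r \<in> T'" "s \<in> T'" for r s
      unfolding X'_def Y'_def using that t(1) by (intro diff mult Suc.prems(2)) (auto dest: T'T)
    show "\<not> p dvd Y' r r" if "r \<in> T'" for r
    proof
      assume "p dvd Y' r r"
      then have "p dvd Y' r r + Y r t * Y t r"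
        using pt[OF that] by (intro dvd_add dvd_mult)
      then have "p dvd Y t t * Y r r" by (simp add: Y'_def)
      then show False
        using \<open>prime p\<close> Suc.prems(3) t(1) T'T[OF that] by (auto simp: prime_dvd_mult_iff)
    qed
    show "p dvd Y' r s" if "r \<in> T'" "s \<in> T'" "s \<noteq> r" "key r \<le> key s" for r s
      unfolding Y'_def using Suc.prems(4)[of r s] pt[of s] that T'T
      by (intro dvd_diff dvd_mult) auto
    show "(\<Sum>s\<in>T'. X' r s * c s) = 0" if "r \<in> T'" for r
    proof -
      have "(\<Sum>s\<in>T'. X' r s * c s) = X t t * (\<Sum>s\<in>T'. X r s * c s) - X r t * (\<Sum>s\<in>T'. X t s * c s)"
        by (simp add: X'_def sum_distrib_left sum_subtractf algebra_simps)
      moreover have "(\<Sum>s\<in>T'. X r s * c s) = - X r t * c t"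
        using Suc.prems(5)[of r] split[of r] T'T[OF that] by (simp add: eq_neg_iff_add_eq_0 add.commute)
      moreover have "(\<Sum>s\<in>T'. X t s * c s) = - X t t * c t"
        using Suc.prems(5)[of t] split[of t] t(1) by (simp add: eq_neg_iff_add_eq_0 add.commute)
      ultimately show ?thesis by simp
    qed
  qed
  moreover have "X t t \<noteq> 0"
    using Suc.prems(2)[OF t(1) t(1)] Suc.prems(3)[OF t(1)] zero by metis
  ultimately have "c t = 0"
    using Suc.prems(5)[OF t(1)] split[of t] by simp
  then show ?case using \<open>\<forall>s\<in>T'. c s = 0\<close> by (auto simp: T'_def)
qed

section \<open>Congruences and the Frobenius map modulo a prime\<close>

lemma prime_dvd_power_add_diff:
  fixes a b :: "'a::comm_ring_1"
  assumes "prime p"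
  shows "of_nat p dvd (a + b) ^ p - (a ^ p + b ^ p)"
proof -
  have p: "p > 0" using assms by (simp add: prime_gt_0_nat)
  have "{..p} = insert 0 (insert p {1..<p})" using p by auto
  then have "(a + b) ^ p - (a ^ p + b ^ p) = (\<Sum>k\<in>{1..<p}. of_nat (p choose k) * a ^ k * b ^ (p - k))"
    using p by (simp add: binomial_ring)
  moreover have "of_nat p dvd (of_nat (p choose k) :: 'a)" if "k \<in> {1..<p}" for k
    using dvd_choose_prime[of k p] assms that by (auto simp: dvd_def)
  ultimately show ?thesis by (auto intro!: dvd_sum dvd_mult2)
qed

lemma dvd_diff_trans:
  fixes a b c d :: "'a::comm_ring_1"
  assumes "d dvd a - b" "d dvd b - c"
  shows "d dvd a - c"
  using dvd_add[OF assms] by simp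

lemma dvd_diff_mult:
  fixes a b c d m :: "'a::comm_ring_1"
  assumes "m dvd a - b" "m dvd c - d"
  shows "m dvd a * c - b * d"
proof -
  have "a * c - b * d = (a - b) * c + b * (c - d)" by (simp add: algebra_simps)
  then show ?thesis using assms by auto
qed

lemma dvd_diff_power:
  fixes a b m :: "'a::comm_ring_1"
  assumes "m dvd a - b"
  shows "m dvd a ^ n - b ^ n"
  by (induction n) (auto intro: dvd_diff_mult assms)

lemma prime_dvd_power_diff:
  fixes a b :: "'a::comm_ring_1"
  assumes "prime p"
  shows "of_nat p dvd (a - b) ^ p ^ k - (a ^ p ^ k - b ^ p ^ k)"
proof (induction k)
  case (Suc k)
  let ?x = "a ^ p ^ k" and ?y = "b ^ p ^ k"
  have "of_nat p dvd ((a - b) ^ p ^ k) ^ p - (?x - ?y) ^ p"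
    by (rule dvd_diff_power) (rule Suc)
  moreover have "of_nat p dvd (?x - ?y) ^ p - (?x ^ p - ?y ^ p)"
    \<comment> \<open>Additivity is applied to \<open>(?x - ?y) + ?y\<close>, which avoids the sign
      \<open>(-1) ^ p\<close>.\<close>
    using prime_dvd_power_add_diff[OF assms, of "?x - ?y" ?y]
    by (subst dvd_minus_iff[symmetric]) (simp add: algebra_simps dvd_diff_commute)
  ultimately have "of_nat p dvd ((a - b) ^ p ^ k) ^ p - (?x ^ p - ?y ^ p)" by (rule dvd_diff_trans)
  then show ?case by (simp add: power_mult[symmetric] mult.commute)
qed auto

section \<open>Reduction of cyclotomic integers modulo the prime above p\<close>

definition eval_int :: "int poly \<Rightarrow> complex \<Rightarrow> complex" where
  "eval_int f z = poly (map_poly of_int f) z"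

lemma eval_int_diff: "eval_int (f - g) z = eval_int f z - eval_int g z"
proof -
  have "map_poly of_int (f - g) = map_poly of_int f - (map_poly of_int g :: complex poly)"
    by (rule poly_eqI) (simp add: coeff_map_poly)
  then show ?thesis by (simp add: eval_int_def)
qed

lemma eval_int_mult: "eval_int (f * g) z = eval_int f z * eval_int g z"
proof -
  have "map_poly of_int (f * g) = map_poly of_int f * (map_poly of_int g :: complex poly)"
    by (rule poly_eqI) (simp add: coeff_map_poly coeff_mult)
  then show ?thesis by (simp add: eval_int_def)
qed

lemma eval_int_const: "eval_int [:c:] z = of_int c"
  by (simp add: eval_int_def map_poly_pCons)

lemma eval_int_of_nat: "eval_int (of_nat c) z = of_nat c"
  by (simp add: of_nat_poly eval_int_const)

lemma eval_int_monom: "eval_int (monom c n) z = of_int c * z ^ n"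
  by (simp add: eval_int_def map_poly_monom poly_monom)

lemma eval_int_1: "eval_int 1 z = 1"
  by (simp add: eval_int_def)

lemma eval_int_power: "eval_int (f ^ n) z = eval_int f z ^ n"
  by (induction n) (simp_all add: eval_int_1 eval_int_mult)

lemma eval_int_altdef: "eval_int f z = (\<Sum>i\<le>degree f. of_int (coeff f i) * z ^ i)"
  unfolding eval_int_def poly_altdef
  by (rule sum.mono_neutral_cong_left)
     (auto simp: coeff_map_poly degree_map_poly coeff_eq_0 map_poly_degree_leq)

section \<open>Roots of unity and the factors of \<open>w^q - 1\<close>\<close>

definition zeta :: "nat \<Rightarrow> int \<Rightarrow> complex" where
  "zeta q a = cis (2 * pi * of_int a / of_nat q)"

lemma zeta_add: "zeta q (a + b) = zeta q a * zeta q b"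
  by (simp add: zeta_def cis_mult add_divide_distrib ring_distribs)

lemma zeta_0 [simp]: "zeta q 0 = 1"
  by (simp add: zeta_def)

lemma zeta_mult_nat: "zeta q (a * int n) = zeta q a ^ n"
  by (induction n) (simp_all add: zeta_add ring_distribs)

lemma zeta_cong:
  assumes "q > 0" "[a = b] (mod int q)"
  shows "zeta q a = zeta q b"
proof -
  have *: "zeta q x = zeta q (x mod int q)" for x
  proof -
    have "zeta q x = zeta q (x mod int q + int q * (x div int q))" by simp
    also have "\<dots> = zeta q (x mod int q) * zeta q (int q * (x div int q))" by (rule zeta_add)
    also have "zeta q (int q * (x div int q)) = 1"
      using assms(1) by (simp add: zeta_def cis_multiple_2pi mult.assoc[symmetric])
    finally show ?thesis by simp
  qed
  show ?thesis using *[of a] *[of b] assms(2) by (simp add: cong_def)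
qed

lemma zeta_eq_power:
  assumes "q > 0"
  shows "zeta q a = zeta q 1 ^ nat (a mod int q)"
proof -
  have "zeta q a = zeta q (1 * int (nat (a mod int q)))"
    using assms by (intro zeta_cong) (auto simp: cong_def)
  then show ?thesis by (simp only: zeta_mult_nat)
qed

lemma inj_on_zeta:
  assumes "q > 0"
  shows "inj_on (\<lambda>l. zeta q (int l)) {..<q}"
proof -
  have "(\<lambda>l. zeta q (int l)) = (\<lambda>k. cis (2 * pi * real k / real q))"
    by (auto simp: zeta_def)
  then show ?thesis
    using bij_betw_roots_unity[OF assms] by (simp add: bij_betw_def)
qed

lemma prod_linear_power_dvd:
  fixes G :: "complex poly"
  assumes "finite A" "\<And>a. a \<in> A \<Longrightarrow> [:- a, 1:] ^ m dvd G"
  shows "(\<Prod>a\<in>A. [:- a, 1:]) ^ m dvd G"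
proof -
  have cop: "coprime [:- a, 1:] [:- b, 1:]" if "a \<noteq> b" for a b :: complex
  proof (rule coprimeI)
    fix d assume "d dvd [:- a, 1:]" "d dvd [:- b, 1:]"
    then have "d dvd [:- a, 1:] - [:- b, 1:]" by (rule dvd_diff)
    then have "d dvd [:b - a:]" by simp
    moreover have "[:b - a:] dvd 1" using that by (simp add: is_unit_const_poly_iff dvd_field_iff)
    ultimately show "is_unit d" by (rule dvd_trans)
  qed
  from assms have "(\<Prod>a\<in>A. [:- a, 1:] ^ m) dvd G"
  proof (induction A rule: finite_induct)
    case (insert a A)
    have "coprime ([:- a, 1:] ^ m) (\<Prod>a\<in>A. [:- a, 1:] ^ m)"
    proof (rule prod_coprime_right)
      fix b assume "b \<in> A"
      then have "a \<noteq> b" using insert.hyps by auto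
      then show "coprime ([:- a, 1:] ^ m) ([:- b, 1:] ^ m)" using cop by simp
    qed
    then show ?case using insert by (simp add: divides_mult)
  qed auto
  then show ?thesis by (simp add: prod_power_distrib)
qed

text \<open>The \<open>q\<close> distinct roots of unity give a product \<open>P\<close> of linear
  factors that divides \<open>1 - monom 1 q\<close>. Both have degree \<open>q\<close>, so they
  differ by a unit, and divisibility can be checked at each root.\<close>

lemma cyclotomic_power_dvd:
  fixes G :: "complex poly"
  assumes q: "q > 0" and G: "\<And>l. l < q \<Longrightarrow> [:- zeta q (int l), 1:] ^ m dvd G"
  shows "(1 - monom 1 q) ^ m dvd G"
proof -
  define A where "A = (\<lambda>l. zeta q (int l)) ` {..<q}"
  define P where "P = (\<Prod>a\<in>A. [:- a, 1:])"
  have A: "finite A" "card A = q" by (auto simp: A_def card_image inj_on_zeta[OF q])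
  have root: "a ^ q = 1" if "a \<in> A" for a
  proof -
    from that obtain l where "a = zeta q (int l)" by (auto simp: A_def)
    then have "a ^ q = zeta q (int l * int q)" by (simp only: zeta_mult_nat)
    also have "\<dots> = zeta q 0" using q by (intro zeta_cong) (auto simp: cong_def)
    finally show ?thesis by simp
  qed
  have "P ^ 1 dvd 1 - monom 1 q" unfolding P_def
    using A root by (intro prod_linear_power_dvd) (auto simp: poly_monom poly_eq_0_iff_dvd[symmetric])
  then obtain r where r: "1 - monom 1 q = P * r" by (auto elim: dvdE)
  have nz: "1 - monom 1 q \<noteq> (0 :: complex poly)"
  proof
    assume "1 - monom 1 q = (0 :: complex poly)"
    then have "coeff (1 - monom 1 q :: complex poly) q = 0" by simp
    then show False using q by simp
  qed
  have degP: "degree P = q"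
    unfolding P_def using A by (subst degree_prod_sum_eq) auto
  have "degree (1 - monom 1 q :: complex poly) \<le> q"
    by (rule degree_diff_le) (auto simp: degree_monom_le)
  moreover have "degree (1 - monom 1 q :: complex poly) = degree P + degree r"
    using nz unfolding r by (intro degree_mult_eq) auto
  ultimately have "degree r = 0" using degP by simp
  then obtain c where "r = [:c:]" by (auto elim: degree_eq_zeroE)
  moreover have "r \<noteq> 0" using nz r by auto
  ultimately have "r dvd 1" by (simp add: is_unit_const_poly_iff dvd_field_iff)
  then have "1 - monom 1 q dvd P" unfolding r by (simp add: mult_unit_dvd_iff)
  then have "(1 - monom 1 q) ^ m dvd P ^ m" by (rule dvd_power_same)
  also have "P ^ m dvd G"
    unfolding P_def using A G by (intro prod_linear_power_dvd) (auto simp: A_def)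
  finally show ?thesis .
qed

text \<open>
  Writing \<open>f(1) = (1 - \<zeta>) * g(\<zeta>)\<close> gives \<open>f(1)^q \<in> p * \<int>[\<zeta>]\<close>. If \<open>p\<close> did not divide \<open>f(1)\<close>, then
  multiplication by \<open>f(1)^q\<close>, expressed in the powers of \<open>\<zeta>\<close>, would give an integer matrix that is
  diagonal with unit entries modulo \<open>p\<close> and still annihilates the nonzero vector \<open>(\<zeta>^j)\<close>.
\<close>

lemma prime_dvd_of_eval_int_zeta_eq_0:
  assumes p: "prime p" and q: "q = p ^ k" and f: "eval_int f (zeta q 1) = 0"
  shows "int p dvd poly f 1"
proof (rule ccontr)
  assume not_dvd: "\<not> int p dvd poly f 1"
  have p': "prime (int p)" and q0: "q > 0" using p q by (auto simp: prime_gt_0_nat)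
  define z where "z = zeta q 1"
  define c where "c = poly f 1"
  have zq: "z ^ (e mod q) = z ^ e" for e
    using zeta_eq_power[OF q0, of "int e"] zeta_mult_nat[of q 1 e]
    by (simp add: z_def zmod_int[symmetric])
  have "[:-1, 1:] dvd f - [:c:]"
    by (subst poly_eq_0_iff_dvd[symmetric]) (simp add: c_def)
  then obtain g where "f - [:c:] = [:-1, 1:] * g" by (auto elim: dvdE)
  then have "eval_int f z - of_int c = eval_int [:-1, 1:] z * eval_int g z"
    by (metis eval_int_diff eval_int_mult eval_int_const)
  then have c1: "of_int c = (1 - z) * eval_int g z"
    using f by (simp add: z_def eval_int_def map_poly_pCons algebra_simps)
  have "of_nat p dvd (1 - monom 1 1 :: int poly) ^ q - (1 ^ q - monom 1 1 ^ q)"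
    unfolding q by (rule prime_dvd_power_diff[OF p])
  then obtain h where h: "(1 - monom 1 1 :: int poly) ^ q - (1 ^ q - monom 1 1 ^ q) = of_nat p * h"
    by (auto elim: dvdE)
  have "eval_int ((1 - monom 1 1 :: int poly) ^ q - (1 ^ q - monom 1 1 ^ q)) z = eval_int (of_nat p * h) z"
    by (simp only: h)
  then have "(1 - z) ^ q = of_nat p * eval_int h z"
    using zq[of q] by (simp add: eval_int_diff eval_int_mult eval_int_power eval_int_1 eval_int_monom
        eval_int_of_nat)
  then have cq: "of_int c ^ q = of_nat p * eval_int (h * g ^ q) z"
    unfolding c1 by (simp add: power_mult_distrib eval_int_mult eval_int_power mult.assoc)
  define H where "H = h * g ^ q"
  \<comment> \<open>\<open>B i j\<close> is the coefficient of \<open>z ^ j\<close> in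
    \<open>H(z) * z ^ i\<close> once exponents are reduced modulo \<open>q\<close>. Row
    \<open>i\<close> of \<open>Y\<close> applied to the powers of \<open>z\<close> thus gives
    \<open>(c ^ q - p * H(z)) * z ^ i\<close>, which is 0.\<close>
  define B where "B = (\<lambda>i j. \<Sum>e | e \<le> degree H \<and> (e + i) mod q = j. coeff H e)"
  define Y where "Y = (\<lambda>i j. (if i = j then c ^ q else 0) - int p * B i j)"
  have "\<forall>j\<in>{..<q}. z ^ j = 0"
  proof (rule triangular_kernel_trivial[where red = "\<lambda>x a. x = of_int a" and p = "int p" and
        key = "\<lambda>_. 0" and X = "\<lambda>i j. of_int (Y i j)" and Y = Y])
    show "\<not> int p dvd Y i i" for i
    proof
      assume "int p dvd Y i i"
      then have "int p dvd Y i i + int p * B i i" by simp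
      then have "int p dvd c ^ q" by (simp add: Y_def)
      then show False using not_dvd p' c_def prime_dvd_power by blast
    qed
    show "(\<Sum>j<q. of_int (Y i j) * z ^ j) = 0" if "i \<in> {..<q}" for i
    proof -
      have "(\<Sum>j<q. of_int (B i j) * z ^ j)
          = (\<Sum>j<q. \<Sum>e | e \<in> {..degree H} \<and> (e + i) mod q = j. of_int (coeff H e) * z ^ (e + i))"
      proof (intro sum.cong refl)
        fix j
        have "z ^ j = z ^ (e + i)" if "(e + i) mod q = j" for e
          using zq[of "e + i"] that by simp
        then have "(\<Sum>e | e \<in> {..degree H} \<and> (e + i) mod q = j. of_int (coeff H e) * z ^ (e + i))
            = (\<Sum>e | e \<in> {..degree H} \<and> (e + i) mod q = j. of_int (coeff H e) * z ^ j)"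
          by (intro sum.cong) auto
        then show "of_int (B i j) * z ^ j
            = (\<Sum>e | e \<in> {..degree H} \<and> (e + i) mod q = j. of_int (coeff H e) * z ^ (e + i))"
          by (simp add: B_def sum_distrib_right)
      qed
      also have "\<dots> = (\<Sum>e\<le>degree H. of_int (coeff H e) * z ^ (e + i))"
        using q0 by (intro sum.group) auto
      also have "\<dots> = eval_int H z * z ^ i"
        by (simp add: eval_int_altdef sum_distrib_right power_add mult.assoc)
      finally have "(\<Sum>j<q. of_int (B i j) * z ^ j) = eval_int H z * z ^ i" .
      moreover have "(\<Sum>j<q. of_int (Y i j) * z ^ j)
          = (\<Sum>j<q. (if j = i then of_int c ^ q * z ^ i else 0) - of_nat p * (of_int (B i j) * z ^ j))"
        by (intro sum.cong) (auto simp: Y_def algebra_simps)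
      ultimately show ?thesis
        using that cq by (simp add: sum_subtractf sum_distrib_left[symmetric] H_def)
    qed
  qed (auto simp: Y_def p)
  then show False using q0 by (auto dest!: bspec[of _ _ 0])
qed

text \<open>
  Reduction modulo the prime above \<open>p\<close>, which sends \<open>\<zeta>\<close> to \<open>1\<close>. It is a relation, so that its
  well-definedness is only needed in the form \<open>cyc_red_0D\<close> below.
\<close>

definition cyc_red :: "nat \<Rightarrow> nat \<Rightarrow> complex \<Rightarrow> int \<Rightarrow> bool" where
  "cyc_red p q x c \<longleftrightarrow> (\<exists>f. x = eval_int f (zeta q 1) \<and> int p dvd poly f 1 - c)"

lemma cyc_red_diff:
  assumes "cyc_red p q x a" "cyc_red p q y b"
  shows "cyc_red p q (x - y) (a - b)"
proof -
  from assms obtain f g where fg: "x = eval_int f (zeta q 1)" "int p dvd poly f 1 - a"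
    "y = eval_int g (zeta q 1)" "int p dvd poly g 1 - b" by (auto simp: cyc_red_def)
  have "int p dvd (poly f 1 - a) - (poly g 1 - b)" using fg(2,4) by (rule dvd_diff)
  then have "int p dvd poly (f - g) 1 - (a - b)" by (simp add: algebra_simps)
  then show ?thesis unfolding cyc_red_def using fg by (metis eval_int_diff)
qed

lemma cyc_red_mult:
  assumes "cyc_red p q x a" "cyc_red p q y b"
  shows "cyc_red p q (x * y) (a * b)"
proof -
  from assms obtain f g where "x = eval_int f (zeta q 1)" "int p dvd poly f 1 - a"
    "y = eval_int g (zeta q 1)" "int p dvd poly g 1 - b" by (auto simp: cyc_red_def)
  then show ?thesis unfolding cyc_red_def
    by (intro exI[of _ "f * g"]) (auto simp: eval_int_mult intro: dvd_diff_mult)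
qed

lemma cyc_red_of_int: "cyc_red p q (of_int c) c"
  unfolding cyc_red_def by (intro exI[of _ "[:c:]"]) (simp add: eval_int_const)

lemma cyc_red_zeta: "q > 0 \<Longrightarrow> cyc_red p q (zeta q a) 1"
  unfolding cyc_red_def
  by (intro exI[of _ "monom 1 (nat (a mod int q))"]) (simp add: eval_int_monom zeta_eq_power[of q a] poly_monom)

lemma cyc_red_add:
  assumes "cyc_red p q x a" "cyc_red p q y b"
  shows "cyc_red p q (x + y) (a + b)"
  using cyc_red_diff[OF assms(1) cyc_red_diff[OF cyc_red_of_int[of p q 0] assms(2)]] by simp

lemma cyc_red_sum:
  "(\<And>i. i \<in> A \<Longrightarrow> cyc_red p q (x i) (a i)) \<Longrightarrow> cyc_red p q (sum x A) (sum a A)"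
  by (induction A rule: infinite_finite_induct)
     (auto intro: cyc_red_add cyc_red_of_int[of p q 0, simplified])

lemma cyc_red_0D:
  assumes "prime p" "q = p ^ k" "cyc_red p q 0 c"
  shows "int p dvd c"
proof -
  from assms(3) obtain f where f: "eval_int f (zeta q 1) = 0" "int p dvd poly f 1 - c"
    by (auto simp: cyc_red_def)
  have "int p dvd poly f 1" using assms(1,2) f(1) by (rule prime_dvd_of_eval_int_zeta_eq_0)
  from dvd_diff[OF this f(2)] show ?thesis by simp
qed

section \<open>A polynomial system that is triangular modulo p\<close>

text \<open>
  The exponent vector \<open>t\<close> encodes the direction \<open>t(0 := 1)\<close>; its entry \<open>t 0\<close> is not part of the
  direction and counts factors \<open>1 - z 0\<close> instead.
\<close>

definition basis_poly :: "nat \<Rightarrow> (nat \<Rightarrow> nat) \<Rightarrow> (nat \<Rightarrow> 'a::comm_ring_1) \<Rightarrow> 'a" where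
  "basis_poly n t z = (1 - z 0) ^ t 0 * (\<Prod>i\<in>{1..<n}. \<Prod>s<t i. z 0 ^ s - z i)"

text \<open>The order at \<open>w = 1\<close> modulo \<open>p\<close> of the product over
  \<open>i \<ge> 1\<close> in \<open>basis_poly n t\<close> on the curve of \<open>t\<close>: the
  factor \<open>w^s - w^(t i)\<close> contributes the \<open>p\<close>-part of
  \<open>t i - s\<close>.\<close>

definition excess :: "nat \<Rightarrow> nat \<Rightarrow> (nat \<Rightarrow> nat) \<Rightarrow> nat" where
  "excess p n t = (\<Sum>i\<in>{1..<n}. \<Sum>s<t i. p ^ multiplicity p (t i - s))"

text \<open>The reduction of \<open>g\<close> modulo \<open>p\<close> has order exactly
  \<open>v\<close> at \<open>w = 1\<close>, since the cofactor \<open>h\<close> is nonzero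
  there.\<close>

definition order_mod :: "nat \<Rightarrow> nat \<Rightarrow> int poly \<Rightarrow> bool" where
  "order_mod p v g \<longleftrightarrow> (\<exists>h. \<not> int p dvd poly h 1 \<and> of_nat p dvd g - (1 - monom 1 1) ^ v * h)"

lemma order_mod_mult:
  assumes "prime p" "order_mod p v f" "order_mod p w g"
  shows "order_mod p (v + w) (f * g)"
proof -
  from assms obtain h h' where h: "\<not> int p dvd poly h 1" "of_nat p dvd f - (1 - monom 1 1) ^ v * h"
    "\<not> int p dvd poly h' 1" "of_nat p dvd g - (1 - monom 1 1) ^ w * h'"
    by (auto simp: order_mod_def)
  have "of_nat p dvd f * g - (1 - monom 1 1) ^ (v + w) * (h * h')"
    using dvd_diff_mult[OF h(2,4)] by (simp add: power_add mult_ac)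
  moreover have "\<not> int p dvd poly (h * h') 1"
    using h(1,3) assms(1) by (simp add: prime_dvd_mult_iff)
  ultimately show ?thesis unfolding order_mod_def by (intro exI conjI)
qed

lemma order_mod_1: "prime p \<Longrightarrow> order_mod p 0 1"
  unfolding order_mod_def by (intro exI[of _ 1]) (auto dest: not_prime_unit)

lemma order_mod_prod:
  assumes "prime p" "\<And>i. i \<in> A \<Longrightarrow> order_mod p (v i) (f i)"
  shows "order_mod p (\<Sum>i\<in>A. v i) (\<Prod>i\<in>A. f i)"
  using assms(2)
  by (induction A rule: infinite_finite_induct) (auto intro: order_mod_1 order_mod_mult assms(1))

lemma order_mod_power:
  assumes "prime p"
  shows "order_mod p v ((1 - monom 1 1) ^ v)"
  unfolding order_mod_def using assms
  by (intro exI[of _ 1]) (auto dest: not_prime_unit)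

lemma order_mod_monom:
  assumes "prime p"
  shows "order_mod p 0 (monom 1 s)"
  unfolding order_mod_def using assms
  by (intro exI[of _ "monom 1 s"]) (auto simp: poly_monom dest: not_prime_unit)

text \<open>With \<open>t = p ^ v * c\<close> and \<open>p\<close> not dividing \<open>c\<close>,
  Frobenius turns \<open>1 - w^t\<close> into \<open>(1 - w^c)^(p^v)\<close>. The cofactor
  \<open>1 + w + ... + w^(c - 1)\<close> of \<open>1 - w\<close> in \<open>1 - w^c\<close> has the
  value \<open>c\<close> at 1, a unit modulo \<open>p\<close>.\<close>

lemma order_mod_one_minus_monom:
  assumes p: "prime p" and "t > 0"
  shows "order_mod p (p ^ multiplicity p t) (1 - monom 1 t)"
proof -
  define v where "v = multiplicity p t"
  obtain c where c: "t = p ^ v * c" "\<not> p dvd c"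
    using multiplicity_decompose'[of t p] assms unfolding v_def
    by (metis not_prime_unit neq0_conv mult.commute)
  define h :: "int poly" where "h = (\<Sum>i<c. monom 1 i)"
  have "1 - monom 1 c = (1 - monom 1 1) * h"
    using one_diff_power_eq[of "monom 1 1 :: int poly" c] by (simp add: h_def monom_power)
  moreover have "of_nat p dvd (1 - monom 1 c :: int poly) ^ p ^ v - (1 ^ p ^ v - monom 1 c ^ p ^ v)"
    by (rule prime_dvd_power_diff[OF p])
  moreover have "monom 1 c ^ p ^ v = (monom 1 t :: int poly)"
    by (simp add: monom_power c(1) mult.commute)
  ultimately have "of_nat p dvd (1 - monom 1 1) ^ p ^ v * h ^ p ^ v - (1 - monom 1 t)"
    by (simp add: power_mult_distrib)
  then have "of_nat p dvd (1 - monom 1 t) - (1 - monom 1 1) ^ p ^ v * h ^ p ^ v"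
    by (metis dvd_minus_iff minus_diff_eq)
  moreover have "poly (h ^ p ^ v) 1 = int (c ^ p ^ v)"
    by (simp add: h_def poly_sum poly_monom)
  moreover have "\<not> p dvd c ^ p ^ v" using p c(2) prime_dvd_power by blast
  ultimately show ?thesis unfolding order_mod_def v_def[symmetric]
    by (metis int_dvd_int_iff)
qed

text \<open>Each factor \<open>w^j - w^(t i)\<close> is \<open>w^j * (1 - w^(t i - j))\<close>, and
  orders add. Letting \<open>s 0\<close> differ from \<open>t 0\<close> covers the diagonal entry
  together with the columns that only the order separates from it.\<close>

lemma order_mod_basis_poly:
  assumes p: "prime p" and st: "\<And>i. i \<in> {1..<n} \<Longrightarrow> s i = t i"
  shows "order_mod p (s 0 + excess p n t) (basis_poly n s (\<lambda>i. monom 1 ((t(0 := 1)) i)))"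
proof -
  have "order_mod p (p ^ multiplicity p (t i - j)) (monom 1 j - monom 1 (t i))" if "j < t i" for i j
  proof -
    have "order_mod p (0 + p ^ multiplicity p (t i - j)) (monom 1 j * (1 - monom 1 (t i - j)))"
      using p that by (intro order_mod_mult order_mod_monom order_mod_one_minus_monom) auto
    moreover have "monom 1 j * (1 - monom 1 (t i - j)) = (monom 1 j - monom 1 (t i) :: int poly)"
      using that by (simp add: algebra_simps mult_monom)
    ultimately show ?thesis by simp
  qed
  then have "order_mod p (s 0 + excess p n t)
      ((1 - monom 1 1) ^ s 0 * (\<Prod>i\<in>{1..<n}. \<Prod>j<t i. monom 1 j - monom 1 (t i)))"
    unfolding excess_def
    by (intro order_mod_mult order_mod_power order_mod_prod p) auto
  also have "(\<Prod>i\<in>{1..<n}. \<Prod>j<t i. monom 1 j - monom 1 (t i))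
      = (\<Prod>i\<in>{1..<n}. \<Prod>j<s i. monom 1 1 ^ j - monom (1::int) ((t(0 := 1)) i))"
    by (intro prod.cong) (auto simp: st monom_power)
  finally show ?thesis by (simp add: basis_poly_def)
qed

text \<open>The inner product over \<open>j < s i\<close> contains the index \<open>j = t i\<close>,
  whose factor is zero on the curve of \<open>t\<close>.\<close>

lemma basis_poly_eq_0:
  assumes "i \<in> {1..<n}" "t i < s i"
  shows "basis_poly n s (\<lambda>i. monom 1 ((t(0 := 1)) i)) = (0 :: int poly)"
proof -
  have "(\<Prod>j<s i. monom 1 1 ^ j - monom 1 ((t(0 := 1)) i)) = (0 :: int poly)"
    using assms by (intro prod_zero, simp, intro bexI[of _ "t i"]) (simp_all add: monom_power)
  then have "(\<Prod>i\<in>{1..<n}. \<Prod>j<s i. monom 1 1 ^ j - monom 1 ((t(0 := 1)) i)) = (0 :: int poly)"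
    using assms(1) by (subst prod.remove[of _ i]) auto
  then show ?thesis by (simp add: basis_poly_def)
qed

section \<open>Coefficients of quotients by \<open>(1 - w^q)^m\<close>\<close>

definition geo :: "nat \<Rightarrow> nat \<Rightarrow> 'a::comm_ring_1 fps" where
  "geo q m = Abs_fps (\<lambda>j. if q dvd j then 1 else 0) ^ m"

text \<open>The base of the power is the geometric series in \<open>w^q\<close>, so
  \<open>geo q m\<close> serves as \<open>1 / (1 - w^q)^m\<close> over any commutative ring, the
  integers included.\<close>

lemma geo_inverse:
  assumes "q > 0"
  shows "(1 - fps_X ^ q) ^ m * geo q m = (1 :: 'a::comm_ring_1 fps)"
proof -
  let ?A = "Abs_fps (\<lambda>j. if q dvd j then 1 else 0) :: 'a fps"
  have "(1 - fps_X ^ q) * ?A = 1"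
  proof (rule fps_ext)
    fix j
    have "q dvd j" "j = 0" if "j < q" "q dvd j" using that by (auto dest: dvd_imp_le)
    then show "fps_nth ((1 - fps_X ^ q) * ?A) j = fps_nth 1 j"
      using assms by (auto simp: left_diff_distrib fps_X_power_mult_nth dvd_minus_self)
  qed
  then show ?thesis unfolding geo_def by (simp add: power_mult_distrib[symmetric])
qed

text \<open>
  The coefficient of \<open>w^e\<close> in \<open>G * (1 - w)^(q * m - 1 - r) / (1 - w^q)^m\<close>. For large \<open>e\<close> it annihilates
  the multiples of \<open>(1 - w^q)^m\<close>, while modulo \<open>p\<close>, where the denominator becomes \<open>(1 - w)^(q * m)\<close>, it
  tells order \<open>r\<close> at \<open>w = 1\<close> from any larger order.
\<close>

definition quot_coeff :: "nat \<Rightarrow> nat \<Rightarrow> nat \<Rightarrow> nat \<Rightarrow> 'a::comm_ring_1 poly \<Rightarrow> 'a" where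
  "quot_coeff q m r e G = fps_nth (fps_of_poly G * (1 - fps_X) ^ (q * m - 1 - r) * geo q m) e"

lemma quot_coeff_eq_0:
  fixes G :: "'a::comm_ring_1 poly"
  assumes "q > 0" "(1 - monom 1 q) ^ m dvd G"
  shows "\<forall>\<^sub>F e in sequentially. quot_coeff q m r e G = 0"
proof -
  from assms obtain H where H: "G = (1 - monom 1 q) ^ m * H" by (auto elim: dvdE)
  define K where "K = H * (1 - monom 1 1) ^ (q * m - 1 - r)"
  have "fps_of_poly G * (1 - fps_X) ^ (q * m - 1 - r) * geo q m
      = ((1 - fps_X ^ q) ^ m * geo q m) * fps_of_poly K"
    by (simp add: H K_def fps_of_poly_simps mult_ac)
  then have "quot_coeff q m r e G = coeff K e" for e
    by (simp add: quot_coeff_def geo_inverse assms(1))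
  moreover have "\<forall>\<^sub>F e in sequentially. coeff K e = 0"
    using eventually_gt_at_top[of "degree K"] by eventually_elim (simp add: coeff_eq_0)
  ultimately show ?thesis by simp
qed

lemma quot_coeff_sum:
  "quot_coeff q m r e (\<Sum>i\<in>A. smult (c i) (G i)) = (\<Sum>i\<in>A. c i * quot_coeff q m r e (G i))"
  by (simp add: quot_coeff_def fps_of_poly_sum fps_of_poly_smult sum_distrib_right fps_sum_nth mult.assoc)

lemma fps_of_poly_of_nat: "fps_of_poly (of_nat c) = of_nat c"
  by (induction c) (simp_all add: fps_of_poly_add)

lemma dvd_fps_nth:
  fixes a b :: "int fps"
  assumes "of_nat p dvd a - b"
  shows "int p dvd fps_nth a e - fps_nth b e"
proof -
  from assms obtain c where "a - b = of_nat p * c" by (auto elim: dvdE)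
  then have "fps_nth a e - fps_nth b e = int p * fps_nth c e"
    by (metis fps_sub_nth fps_of_nat fps_mult_left_const_nth)
  then show ?thesis by simp
qed

lemma quot_coeff_order_mod:
  assumes p: "prime p" and q: "q = p ^ k" and "r < q * m"
    and h: "of_nat p dvd g - (1 - monom 1 1) ^ v * h"
  shows "int p dvd quot_coeff q m r e g
           - fps_nth ((1 - fps_X) ^ (q * m - 1 - r + v) * geo q m * fps_of_poly h) e"
proof -
  have "of_nat p dvd fps_of_poly g - fps_of_poly ((1 - monom 1 1) ^ v * h)"
    using h unfolding fps_of_poly_diff[symmetric]
    by (elim dvdE) (simp add: fps_of_poly_mult fps_of_poly_of_nat)
  then have "of_nat p dvd fps_of_poly g * ((1 - fps_X) ^ (q * m - 1 - r) * geo q m)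
      - fps_of_poly ((1 - monom 1 1) ^ v * h) * ((1 - fps_X) ^ (q * m - 1 - r) * geo q m)"
    by (rule dvd_diff_mult) simp
  then have "of_nat p dvd fps_of_poly g * (1 - fps_X) ^ (q * m - 1 - r) * geo q m
      - (1 - fps_X) ^ (q * m - 1 - r + v) * geo q m * fps_of_poly h"
    by (simp add: fps_of_poly_simps power_add mult_ac)
  then show ?thesis unfolding quot_coeff_def by (rule dvd_fps_nth)
qed

text \<open>Frobenius identifies \<open>(1 - w)^q\<close> with \<open>1 - w^q\<close> modulo
  \<open>p\<close>, so \<open>geo q m\<close> becomes the inverse of
  \<open>(1 - w)^(q * m)\<close>.\<close>

lemma dvd_geo:
  assumes p: "prime p" and q: "q = p ^ k"
  shows "of_nat p dvd (1 - fps_X) ^ (q * m) * geo q m - (1 :: int fps)"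
proof -
  have q0: "q > 0" using p q by (simp add: prime_gt_0_nat)
  have "of_nat p dvd (1 - fps_X :: int fps) ^ q - (1 ^ q - fps_X ^ q)"
    unfolding q by (rule prime_dvd_power_diff[OF p])
  then have "of_nat p dvd ((1 - fps_X :: int fps) ^ q) ^ m - (1 - fps_X ^ q) ^ m"
    by (intro dvd_diff_power) simp
  then have "of_nat p dvd ((1 - fps_X :: int fps) ^ q) ^ m * geo q m - (1 - fps_X ^ q) ^ m * geo q m"
    by (rule dvd_diff_mult) simp
  then show ?thesis by (simp add: geo_inverse[OF q0] power_mult)
qed

text \<open>For \<open>v > r\<close> the numerator contains \<open>1 - w\<close> to an exponent of
  at least \<open>q * m\<close>. The denominator cancels modulo \<open>p\<close> and leaves the
  polynomial \<open>K\<close>, whose coefficients vanish beyond its degree.\<close>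

lemma dvd_quot_coeff:
  assumes p: "prime p" and q: "q = p ^ k" and r: "r < q * m" "r < v" and g: "order_mod p v g"
  shows "\<forall>\<^sub>F e in sequentially. int p dvd quot_coeff q m r e g"
proof -
  from g obtain h where h: "of_nat p dvd g - (1 - monom 1 1) ^ v * h"
    by (auto simp: order_mod_def)
  define K where "K = (1 - monom 1 1) ^ (v - 1 - r) * h"
  have eq: "q * m - 1 - r + v = q * m + (v - 1 - r)" using r by simp
  have "of_nat p dvd ((1 - fps_X) ^ (q * m) * geo q m) * fps_of_poly K - 1 * fps_of_poly K"
    by (rule dvd_diff_mult[OF dvd_geo[OF p q]]) simp
  then have "of_nat p dvd (1 - fps_X) ^ (q * m - 1 - r + v) * geo q m * fps_of_poly h - fps_of_poly K"
    unfolding eq K_def by (simp add: fps_of_poly_simps power_add mult_ac)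
  then have "int p dvd quot_coeff q m r e g - coeff K e" for e
    using dvd_diff_trans[OF quot_coeff_order_mod[OF p q r(1) h] dvd_fps_nth[of p _ "fps_of_poly K" e]]
    by simp
  then have "int p dvd quot_coeff q m r e g" if "e > degree K" for e
    using that by (metis coeff_eq_0 diff_zero)
  then show ?thesis by (rule eventually_mono[OF eventually_gt_at_top[of "degree K"]])
qed

text \<open>At order exactly \<open>r\<close> one factor \<open>1 - w\<close> of the denominator
  survives. The coefficients of \<open>h / (1 - w)\<close> are partial sums of those of
  \<open>h\<close>, eventually \<open>poly h 1\<close>, which is nonzero modulo
  \<open>p\<close>.\<close>

lemma not_dvd_quot_coeff:
  assumes p: "prime p" and q: "q = p ^ k" and r: "r < q * m" and g: "order_mod p r g"
  shows "\<forall>\<^sub>F e in sequentially. \<not> int p dvd quot_coeff q m r e g"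
proof -
  from g obtain h where h: "of_nat p dvd g - (1 - monom 1 1) ^ r * h" "\<not> int p dvd poly h 1"
    by (auto simp: order_mod_def)
  let ?G = "geo 1 1 :: int fps"
  have eq: "q * m = Suc (q * m - 1 - r + r)" using r by simp
  have "of_nat p dvd ((1 - fps_X) ^ (q * m) * geo q m) * (?G * fps_of_poly h) - 1 * (?G * fps_of_poly h)"
    by (rule dvd_diff_mult[OF dvd_geo[OF p q]]) simp
  moreover have "((1 - fps_X) ^ (q * m) * geo q m) * (?G * fps_of_poly h)
      = ((1 - fps_X ^ 1) ^ 1 * ?G) * ((1 - fps_X) ^ (q * m - 1 - r + r) * geo q m * fps_of_poly h)"
    by (subst (1) eq) (simp add: mult_ac)
  ultimately have "of_nat p dvd (1 - fps_X) ^ (q * m - 1 - r + r) * geo q m * fps_of_poly h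
      - ?G * fps_of_poly h"
    by (simp only: geo_inverse[of 1] mult_1 zero_less_one)
  then have *: "int p dvd quot_coeff q m r e g - fps_nth (?G * fps_of_poly h) e" for e
    using dvd_diff_trans[OF quot_coeff_order_mod[OF p q r h(1)] dvd_fps_nth[of p _ "?G * fps_of_poly h" e]]
    by simp
  have "fps_nth (?G * fps_of_poly h) e = poly h 1" if "e \<ge> degree h" for e
  proof -
    have "fps_nth (?G * fps_of_poly h) e = (\<Sum>i=0..e. coeff h i)"
      by (subst mult.commute) (simp add: fps_mult_nth geo_def)
    also have "\<dots> = (\<Sum>i\<le>degree h. coeff h i)"
      using that by (intro sum.mono_neutral_right) (auto simp: coeff_eq_0)
    finally show ?thesis by (simp add: poly_altdef)
  qed
  then have "\<not> int p dvd quot_coeff q m r e g" if "e \<ge> degree h" for e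
    using *[of e] h(2) that by (metis dvd_diff_left_iff dvd_diff_commute)
  then show ?thesis by (rule eventually_mono[OF eventually_ge_at_top[of "degree h"]])
qed

section \<open>Reduction of power series coefficients\<close>

definition fps_red :: "nat \<Rightarrow> nat \<Rightarrow> complex fps \<Rightarrow> int fps \<Rightarrow> bool" where
  "fps_red p q F f \<longleftrightarrow> (\<forall>i. cyc_red p q (fps_nth F i) (fps_nth f i))"

lemma fps_red_diff: "fps_red p q F f \<Longrightarrow> fps_red p q G g \<Longrightarrow> fps_red p q (F - G) (f - g)"
  by (auto simp: fps_red_def intro: cyc_red_diff)

lemma fps_red_mult: "fps_red p q F f \<Longrightarrow> fps_red p q G g \<Longrightarrow> fps_red p q (F * G) (f * g)"
  by (auto simp: fps_red_def fps_mult_nth intro!: cyc_red_sum cyc_red_mult)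

lemma fps_red_1: "fps_red p q 1 1"
  using cyc_red_of_int[of p q 0] cyc_red_of_int[of p q 1] by (simp add: fps_red_def)

lemma fps_red_power: "fps_red p q F f \<Longrightarrow> fps_red p q (F ^ n) (f ^ n)"
  by (induction n) (auto intro: fps_red_1 fps_red_mult)

lemma fps_red_prod:
  "(\<And>i. i \<in> A \<Longrightarrow> fps_red p q (F i) (f i)) \<Longrightarrow> fps_red p q (prod F A) (prod f A)"
  by (induction A rule: infinite_finite_induct) (auto intro: fps_red_1 fps_red_mult)

lemma fps_red_monom:
  "q > 0 \<Longrightarrow> fps_red p q (fps_of_poly (monom (zeta q a) u)) (fps_of_poly (monom 1 u))"
  using cyc_red_of_int[of p q 0] by (auto simp: fps_red_def coeff_monom cyc_red_zeta)

lemma fps_red_geo: "fps_red p q (geo q m) (geo q m)"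
  unfolding geo_def using cyc_red_of_int[of p q 0] cyc_red_of_int[of p q 1]
  by (intro fps_red_power) (auto simp: fps_red_def)

lemma fps_red_X: "fps_red p q fps_X fps_X"
  using cyc_red_of_int[of p q 0] cyc_red_of_int[of p q 1] by (auto simp: fps_red_def fps_X_def)

lemma fps_of_poly_basis_poly: "fps_of_poly (basis_poly n t z) = basis_poly n t (\<lambda>i. fps_of_poly (z i))"
  by (simp add: basis_poly_def fps_of_poly_simps)

text \<open>All values of \<open>zeta\<close> reduce to 1, so the base point \<open>a\<close>
  disappears modulo \<open>p\<close> and only the direction \<open>u\<close> of the curve
  remains.\<close>

lemma cyc_red_quot_coeff:
  assumes "q > 0"
  shows "cyc_red p q (quot_coeff q m r e (basis_poly n t (\<lambda>i. monom (zeta q (a i)) (u i))))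
           (quot_coeff q m r e (basis_poly n t (\<lambda>i. monom 1 (u i))))"
proof -
  have "fps_red p q (fps_of_poly (basis_poly n t (\<lambda>i. monom (zeta q (a i)) (u i))))
      (fps_of_poly (basis_poly n t (\<lambda>i. monom 1 (u i))))"
    unfolding fps_of_poly_basis_poly unfolding basis_poly_def
    by (intro fps_red_mult fps_red_power fps_red_diff fps_red_1 fps_red_prod fps_red_monom assms)
  then show ?thesis
    unfolding quot_coeff_def
    by (intro fps_red_mult[THEN fps_red_def[THEN iffD1], rule_format] fps_red_mult fps_red_power
        fps_red_diff fps_red_1 fps_red_X fps_red_geo)
qed

section \<open>Counting exponents and Taylor expansions\<close>

definition simplex :: "nat \<Rightarrow> nat \<Rightarrow> (nat \<Rightarrow> nat) set" where
  "simplex n m = {t \<in> {..<n} \<rightarrow>\<^sub>E UNIV. (\<Sum>i<n. t i) < m}"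

lemma simplex_less:
  assumes "t \<in> simplex n m" "i < n"
  shows "t i < m"
proof -
  have "t i \<le> (\<Sum>i<n. t i)" using assms(2) by (intro member_le_sum) auto
  then show ?thesis using assms(1) by (simp add: simplex_def)
qed

lemma finite_simplex: "finite (simplex n m)"
proof (rule finite_subset)
  show "simplex n m \<subseteq> {..<n} \<rightarrow>\<^sub>E {..<m}"
    by (auto simp: PiE_iff simplex_less) (auto simp: simplex_def PiE_iff extensional_def)
qed (auto intro: finite_PiE)

lemma simplex_fun_upd:
  assumes "t \<in> simplex n m" "i < n" "(\<Sum>i<n. t i) + x < m' + t i"
  shows "t(i := x) \<in> simplex n m'"
proof -
  have "(\<Sum>k<n. (t(i := x)) k) = x + (\<Sum>k\<in>{..<n} - {i}. t k)"
    using assms(2) by (subst sum.remove[of _ i]) auto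
  moreover have "(\<Sum>k<n. t k) = t i + (\<Sum>k\<in>{..<n} - {i}. t k)"
    using assms(2) by (subst sum.remove[of _ i]) auto
  ultimately show ?thesis using assms by (auto simp: simplex_def PiE_iff extensional_def)
qed

lemma card_simplex: "card (simplex n (Suc m)) = (m + n) choose n"
proof (induction n arbitrary: m)
  case 0
  have "simplex 0 (Suc m) = {\<lambda>_. undefined}" by (auto simp: simplex_def)
  then show ?case by simp
next
  case (Suc n)
  \<comment> \<open>\<open>F j\<close> holds the vectors with last entry \<open>m - j\<close>, whose
    other \<open>n\<close> entries sum to at most \<open>j\<close>. The resulting binomial
    coefficients add up by the hockey-stick identity.\<close>
  define F where "F = (\<lambda>j. (\<lambda>t. t(n := m - j)) ` simplex n (Suc j))"
  have sum_upd: "(\<Sum>i<n. (t(n := x)) i) = (\<Sum>i<n. t i)" for t :: "nat \<Rightarrow> nat" and x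
    by (intro sum.cong) auto
  have "simplex (Suc n) (Suc m) = (\<Union>j\<le>m. F j)"
  proof (intro equalityI subsetI)
    fix t assume t: "t \<in> simplex (Suc n) (Suc m)"
    define t' where "t' = t(n := undefined)"
    have "t n \<le> m" using simplex_less[OF t, of n] by simp
    moreover have "t' \<in> simplex n (Suc (m - t n))"
      using t sum_upd[of t undefined] by (auto simp: simplex_def t'_def PiE_iff extensional_def)
    moreover have "t = t'(n := t n)" by (simp add: t'_def)
    ultimately show "t \<in> (\<Union>j\<le>m. F j)"
      unfolding F_def by (intro UN_I[of "m - t n"]) auto
  next
    fix t assume "t \<in> (\<Union>j\<le>m. F j)"
    then obtain j s where "j \<le> m" "s \<in> simplex n (Suc j)" "t = s(n := m - j)"
      by (auto simp: F_def)
    then show "t \<in> simplex (Suc n) (Suc m)"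
      using sum_upd[of s "m - j"] by (auto simp: simplex_def PiE_iff extensional_def)
  qed
  moreover have "card (F j) = (j + n) choose n" for j
  proof -
    have "inj_on (\<lambda>t. t(n := m - j)) (simplex n (Suc j))"
    proof (rule inj_onI)
      fix s t assume st: "s \<in> simplex n (Suc j)" "t \<in> simplex n (Suc j)" "s(n := m - j) = t(n := m - j)"
      have "s n = t n" using st(1,2) by (auto simp: simplex_def PiE_iff extensional_def)
      then show "s = t" using st(3) by (metis fun_upd_triv fun_upd_upd)
    qed
    then show ?thesis unfolding F_def by (simp add: card_image Suc)
  qed
  moreover have "F i \<inter> F j = {}" if "i \<le> m" "j \<le> m" "i \<noteq> j" for i j
  proof -
    have "t n = m - k" if "t \<in> F k" for t k using that by (auto simp: F_def)
    then show ?thesis using that by (metis disjoint_iff diff_diff_cancel)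
  qed
  then have "card (\<Union>j\<le>m. F j) = (\<Sum>j\<le>m. card (F j))"
    by (intro card_UN_disjoint) (auto simp: F_def finite_simplex)
  ultimately show ?case
    using choose_rising_sum(1)[of n m] by (simp add: add_ac)
qed

text \<open>\<open>fact n\<close> times the binomial coefficient is
  \<open>(m + 1) * ... * (m + n)\<close>, and each factor lies between \<open>m + 1\<close> and
  \<open>m + n\<close>.\<close>

lemma fact_binomial_bounds:
  "real (m + 1) ^ n \<le> fact n * real ((m + n) choose n)"
  "fact n * real ((m + n) choose n) \<le> real (m + n) ^ n"
proof -
  have step: "fact (Suc n) * real ((m + Suc n) choose Suc n)
      = real (m + Suc n) * (fact n * real ((m + n) choose n))" for n
  proof -
    have "real (Suc n * ((m + Suc n) choose Suc n)) = real (Suc (m + n) * ((m + n) choose n))"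
      using Suc_times_binomial_eq[of "m + n" n] by (simp add: mult.commute)
    moreover have "fact (Suc n) * x = fact n * (real (Suc n) * x)" for x :: real by simp
    ultimately show ?thesis by (simp only: of_nat_mult add_Suc_right mult.left_commute)
  qed
  show "real (m + 1) ^ n \<le> fact n * real ((m + n) choose n)"
  proof (induction n)
    case (Suc n)
    show ?case unfolding step power_Suc by (intro mult_mono Suc) auto
  qed simp
  show "fact n * real ((m + n) choose n) \<le> real (m + n) ^ n"
  proof (induction n)
    case (Suc n)
    have "real (m + n) ^ n \<le> real (m + Suc n) ^ n" by (intro power_mono) auto
    then show ?case unfolding step power_Suc using Suc by (intro mult_mono) auto
  qed simp
qed

text \<open>There are at most \<open>b div d\<close> multiples of \<open>d\<close> among
  \<open>1..b\<close>, and each contributes \<open>d\<close>.\<close>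

lemma sum_dvd_le:
  "(\<Sum>i<b. if d dvd Suc i then d else 0) \<le> (b :: nat)"
proof (cases "d = 0")
  case False
  have "(\<Sum>i<b. if d dvd Suc i then d else 0) = (\<Sum>i\<in>{i\<in>{..<b}. d dvd Suc i}. d)"
    by (subst sum.inter_filter) auto
  also have "\<dots> = d * card (Suc ` {i\<in>{..<b}. d dvd Suc i})"
    by (simp add: card_image)
  finally have eq: "(\<Sum>i<b. if d dvd Suc i then d else 0) = d * card (Suc ` {i\<in>{..<b}. d dvd Suc i})" .
  have "card (Suc ` {i\<in>{..<b}. d dvd Suc i}) \<le> card ((*) d ` {1..b div d})"
  proof (intro card_mono subsetI)
    fix x assume "x \<in> Suc ` {i\<in>{..<b}. d dvd Suc i}"
    then have x: "d dvd x" "0 < x" "x \<le> b" by auto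
    then obtain c where c: "x = d * c" by (elim dvdE)
    then have "c \<le> b div d" using div_le_mono[OF x(3), of d] False c by simp
    moreover have "c \<ge> 1" using c x(2) by (cases c) auto
    ultimately show "x \<in> (*) d ` {1..b div d}" using c by auto
  qed simp
  also have "\<dots> \<le> b div d"
    using card_image_le[of "{1..b div d}" "(*) d"] by simp
  finally have "d * card (Suc ` {i\<in>{..<b}. d dvd Suc i}) \<le> d * (b div d)" by (rule mult_le_mono2)
  also have "\<dots> \<le> b" by (rule times_div_less_eq_dividend)
  finally show ?thesis unfolding eq .
qed simp

text \<open>The \<open>p\<close>-part of \<open>x\<close> is one of the powers \<open>p ^ j\<close>
  with \<open>j < l\<close> that divide \<open>x\<close>, so it is at most their sum. After the sums
  are exchanged, each \<open>j\<close> contributes at most \<open>b\<close>.\<close>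

lemma sum_power_multiplicity_le:
  assumes p: "prime p" and b: "b < p ^ l"
  shows "(\<Sum>s<b. p ^ multiplicity p (b - s)) \<le> l * b"
proof -
  have "(\<Sum>s<b. p ^ multiplicity p (b - s)) = (\<Sum>s<b. p ^ multiplicity p (Suc (b - Suc s)))"
    by (intro sum.cong) (auto simp: Suc_diff_Suc)
  also have "\<dots> = (\<Sum>i<b. p ^ multiplicity p (Suc i))"
    by (rule sum.nat_diff_reindex)
  also have "\<dots> \<le> (\<Sum>i<b. \<Sum>j<l. if p ^ j dvd Suc i then p ^ j else 0)"
  proof (intro sum_mono)
    fix i assume i: "i \<in> {..<b}"
    define v where "v = multiplicity p (Suc i)"
    have v: "p ^ v dvd Suc i" unfolding v_def by (rule multiplicity_dvd)
    then have "p ^ v \<le> Suc i" by (rule dvd_imp_le) simp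
    then have "p ^ v < p ^ l" using i b by simp
    then have "v < l" using p by (metis power_less_imp_less_exp prime_gt_1_nat)
    then show "p ^ v \<le> (\<Sum>j<l. if p ^ j dvd Suc i then p ^ j else 0)"
      using v member_le_sum[of v "{..<l}" "\<lambda>j. if p ^ j dvd Suc i then p ^ j else 0"] by simp
  qed
  also have "\<dots> = (\<Sum>j<l. \<Sum>i<b. if p ^ j dvd Suc i then p ^ j else 0)"
    by (rule sum.swap)
  also have "\<dots> \<le> (\<Sum>j<l. b)" by (intro sum_mono sum_dvd_le)
  finally show ?thesis by simp
qed

text \<open>Coordinate \<open>i\<close> contributes at most \<open>l * t i\<close>, so the whole
  order is at most \<open>l * (D - 1)\<close>. The bound on \<open>D\<close> also keeps every
  \<open>t i\<close> below \<open>p ^ l\<close>.\<close>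

lemma excess_less:
  assumes p: "prime p" and "l \<ge> 1" and D: "(D - 1) * l < p ^ l" and t: "t \<in> simplex n D" and "n \<ge> 1"
  shows "t 0 + excess p n t < p ^ l"
proof -
  have "{..<n} = insert 0 {1..<n}" using \<open>n \<ge> 1\<close> by auto
  then have sum: "(\<Sum>i<n. t i) = t 0 + (\<Sum>i\<in>{1..<n}. t i)" by simp
  have "D - 1 \<le> (D - 1) * l" using \<open>l \<ge> 1\<close> by simp
  then have less: "t i < p ^ l" if "i < n" for i
    using simplex_less[OF t that] D by linarith
  have "excess p n t \<le> (\<Sum>i\<in>{1..<n}. l * t i)"
    unfolding excess_def by (intro sum_mono sum_power_multiplicity_le p less) auto
  moreover have "t 0 \<le> l * t 0" using \<open>l \<ge> 1\<close> by simp
  ultimately have "t 0 + excess p n t \<le> l * (\<Sum>i<n. t i)"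
    unfolding sum ring_distribs sum_distrib_left by linarith
  moreover have "(\<Sum>i<n. t i) < D" using t by (simp add: simplex_def)
  then have "(\<Sum>i<n. t i) \<le> D - 1" by linarith
  then have "l * (\<Sum>i<n. t i) \<le> l * (D - 1)" by (rule mult_le_mono2)
  moreover have "l * (D - 1) < p ^ l" using D by (subst mult.commute)
  ultimately show ?thesis by linarith
qed

section \<open>Taylor expansions along curves\<close>

definition taylor :: "nat \<Rightarrow> nat \<Rightarrow> (nat \<Rightarrow> 'a) \<Rightarrow> ((nat \<Rightarrow> nat) \<Rightarrow> 'a) \<Rightarrow> (nat \<Rightarrow> 'a poly) \<Rightarrow> 'a::comm_ring_1 poly" where
  "taylor n m x e z = (\<Sum>t\<in>simplex n m. smult (e t) (\<Prod>i<n. (z i - [:x i:]) ^ t i))"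

text \<open>
  The quantification over \<open>d\<close> covers every curve through the point \<open>x\<close>, in particular all the lines
  through it at once.
\<close>

definition has_taylor :: "nat \<Rightarrow> nat \<Rightarrow> (nat \<Rightarrow> 'a) \<Rightarrow> ((nat \<Rightarrow> 'a poly) \<Rightarrow> 'a::comm_ring_1 poly) \<Rightarrow>
    ((nat \<Rightarrow> nat) \<Rightarrow> 'a) \<Rightarrow> bool" where
  "has_taylor n m x f e \<longleftrightarrow>
     (\<forall>z d. (\<forall>i<n. d dvd z i - [:x i:]) \<longrightarrow> d ^ m dvd f z - taylor n m x e z)"

lemma has_taylor_1: "\<exists>e. has_taylor n m x (\<lambda>_. 1) e"
proof (cases "m = 0")
  case True
  then show ?thesis by (simp add: has_taylor_def)
next
  case False
  define o' where "o' = (\<lambda>i\<in>{..<n}. 0 :: nat)"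
  have o': "o' \<in> simplex n m" using False by (auto simp: o'_def simplex_def)
  have "taylor n m x (\<lambda>t. if t = o' then 1 else 0) z = 1" for z
  proof -
    have "taylor n m x (\<lambda>t. if t = o' then 1 else 0) z
        = (\<Sum>t\<in>simplex n m. if t = o' then \<Prod>i<n. (z i - [:x i:]) ^ t i else 0)"
      unfolding taylor_def by (intro sum.cong) auto
    also have "\<dots> = (\<Prod>i<n. (z i - [:x i:]) ^ o' i)" using o' by (simp add: finite_simplex)
    also have "\<dots> = 1" by (intro prod.neutral) (auto simp: o'_def)
    finally show ?thesis .
  qed
  then show ?thesis unfolding has_taylor_def
    by (intro exI[of _ "\<lambda>t. if t = o' then 1 else 0"]) simp
qed

lemma has_taylor_diff:
  assumes "has_taylor n m x f e" "has_taylor n m x g e'"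
  shows "has_taylor n m x (\<lambda>z. f z - g z) (\<lambda>t. e t - e' t)"
proof -
  have "taylor n m x (\<lambda>t. e t - e' t) z = taylor n m x e z - taylor n m x e' z" for z
    by (simp add: taylor_def smult_diff_left sum_subtractf)
  then have eq: "f z - g z - taylor n m x (\<lambda>t. e t - e' t) z
      = (f z - taylor n m x e z) - (g z - taylor n m x e' z)" for z by simp
  show ?thesis
    unfolding has_taylor_def eq
  proof (intro allI impI, rule dvd_diff)
    fix z d assume d: "\<forall>i<n. d dvd z i - [:x i:]"
    show "d ^ m dvd f z - taylor n m x e z" "d ^ m dvd g z - taylor n m x e' z"
      using d assms unfolding has_taylor_def by simp_all
  qed
qed

lemma smult_sum_right: "smult c (sum f A) = (\<Sum>i\<in>A. smult c (f i))"
  by (induction A rule: infinite_finite_induct) (auto simp: smult_add_right)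

lemma has_taylor_smult:
  assumes "has_taylor n m x f e"
  shows "has_taylor n m x (\<lambda>z. smult c (f z)) (\<lambda>t. c * e t)"
proof -
  have "taylor n m x (\<lambda>t. c * e t) z = smult c (taylor n m x e z)" for z
    by (simp add: taylor_def smult_sum_right)
  then show ?thesis using assms
    by (auto simp: has_taylor_def smult_diff_right[symmetric] intro: dvd_smult)
qed

lemma has_taylor_sum_smult:
  assumes "\<And>i. i \<in> A \<Longrightarrow> has_taylor n m x (f i) (e i)"
  shows "has_taylor n m x (\<lambda>z. \<Sum>i\<in>A. smult (c i) (f i z)) (\<lambda>t. \<Sum>i\<in>A. c i * e i t)"
  using assms
proof (induction A rule: infinite_finite_induct)
  case (insert a A)
  have "has_taylor n m x (\<lambda>z. smult (c a) (f a z)) (\<lambda>t. c a * e a t)"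
    using insert by (intro has_taylor_smult) auto
  moreover have "has_taylor n m x (\<lambda>z. smult (-1) (\<Sum>i\<in>A. smult (c i) (f i z))) (\<lambda>t. -1 * (\<Sum>i\<in>A. c i * e i t))"
    using insert by (intro has_taylor_smult) auto
  ultimately have "has_taylor n m x (\<lambda>z. smult (c a) (f a z) - smult (-1) (\<Sum>i\<in>A. smult (c i) (f i z)))
      (\<lambda>t. c a * e a t - -1 * (\<Sum>i\<in>A. c i * e i t))"
    by (rule has_taylor_diff)
  then show ?case using insert.hyps by simp
qed (auto simp: has_taylor_def taylor_def)

text \<open>Multiplication by \<open>z j - x j\<close> raises the exponent at \<open>j\<close> by
  one. Terms whose degree thereby reaches \<open>m\<close> leave the simplex, but they are multiples
  of \<open>d ^ m\<close>.\<close>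

lemma has_taylor_mult_shift:
  assumes f: "has_taylor n m x f e" and j: "j < n"
  shows "\<exists>e'. has_taylor n m x (\<lambda>z. (z j - [:x j:]) * f z) e'"
proof (intro exI)
  define e' where "e' = (\<lambda>t. if t j = 0 then 0 else e (t(j := t j - 1)))"
  let ?S = "simplex n m"
  show "has_taylor n m x (\<lambda>z. (z j - [:x j:]) * f z) e'"
    unfolding has_taylor_def
  proof (intro allI impI)
    fix z d assume d: "\<forall>i<n. d dvd z i - [:x i:]"
    define y where "y = (\<lambda>t :: nat \<Rightarrow> nat. \<Prod>i<n. (z i - [:x i:]) ^ t i)"
    have y_Suc: "y (t(j := Suc (t j))) = (z j - [:x j:]) * y t" for t
    proof -
      have "y (t(j := Suc (t j))) = (z j - [:x j:]) ^ Suc (t j) * (\<Prod>i\<in>{..<n} - {j}. (z i - [:x i:]) ^ t i)"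
        unfolding y_def using j by (subst prod.remove[of _ j]) auto
      moreover have "y t = (z j - [:x j:]) ^ t j * (\<Prod>i\<in>{..<n} - {j}. (z i - [:x i:]) ^ t i)"
        unfolding y_def using j by (subst prod.remove[of _ j]) auto
      ultimately show ?thesis by (simp add: mult.assoc)
    qed
    have d_y: "d ^ (\<Sum>i<n. t i) dvd y t" for t
      unfolding y_def power_sum by (intro prod_dvd_prod dvd_power_same) (use d in auto)
    let ?B = "{t \<in> ?S. Suc (\<Sum>i<n. t i) < m}"
    have "taylor n m x e' z = (\<Sum>t\<in>{t\<in>?S. t j > 0}. smult (e (t(j := t j - 1))) (y t))"
      unfolding taylor_def e'_def y_def
      by (intro sum.mono_neutral_cong_right) (auto simp: finite_simplex)
    also have "\<dots> = (\<Sum>t\<in>?B. smult (e t) (y (t(j := Suc (t j)))))"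
    proof (rule sum.reindex_bij_witness[where i = "\<lambda>t. t(j := Suc (t j))" and j = "\<lambda>t. t(j := t j - 1)"])
      fix t assume t: "t \<in> {t \<in> ?S. t j > 0}"
      have "(\<Sum>i<n. (t(j := t j - 1)) i) = t j - 1 + (\<Sum>i\<in>{..<n} - {j}. t i)"
        using j by (subst sum.remove[of _ j]) auto
      moreover have "(\<Sum>i<n. t i) = t j + (\<Sum>i\<in>{..<n} - {j}. t i)"
        using j by (subst sum.remove[of _ j]) auto
      ultimately have "Suc (\<Sum>i<n. (t(j := t j - 1)) i) = (\<Sum>i<n. t i)" using t by simp
      moreover have "(\<Sum>i<n. t i) < m" using t by (simp add: simplex_def)
      moreover from this have "t(j := t j - 1) \<in> ?S"
        using t j by (intro simplex_fun_upd[of t n m]) simp_all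
      ultimately show "t(j := t j - 1) \<in> ?B" by simp
    next
      fix t assume "t \<in> ?B"
      then show "t(j := Suc (t j)) \<in> {t \<in> ?S. t j > 0}"
        using j simplex_fun_upd[of t n m j "Suc (t j)" m] by simp
    qed auto
    finally have tay: "taylor n m x e' z = (z j - [:x j:]) * (\<Sum>t\<in>?B. smult (e t) (y t))"
      by (simp add: y_Suc sum_distrib_left)
    have "taylor n m x e z = (\<Sum>t\<in>?B. smult (e t) (y t)) + (\<Sum>t\<in>?S - ?B. smult (e t) (y t))"
      unfolding taylor_def y_def by (subst sum.subset_diff[of ?B]) (auto simp: finite_simplex)
    moreover have "(\<Sum>t\<in>?S - ?B. smult (e t) (y (t(j := Suc (t j)))))
        = (z j - [:x j:]) * (\<Sum>t\<in>?S - ?B. smult (e t) (y t))"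
      by (simp add: y_Suc sum_distrib_left)
    ultimately have "(z j - [:x j:]) * f z - taylor n m x e' z
        = (z j - [:x j:]) * (f z - taylor n m x e z)
          + (\<Sum>t\<in>?S - ?B. smult (e t) (y (t(j := Suc (t j)))))"
      unfolding tay by (simp only: ring_distribs) simp
    moreover have "d ^ m dvd (z j - [:x j:]) * (f z - taylor n m x e z)"
      using f d unfolding has_taylor_def by (intro dvd_mult) blast
    moreover have "d ^ m dvd smult (e t) (y (t(j := Suc (t j))))" if "t \<in> ?S - ?B" for t
    proof -
      have "(\<Sum>i<n. t i) < m" "\<not> Suc (\<Sum>i<n. t i) < m" using that by (simp_all add: simplex_def)
      then have "m = Suc (\<Sum>i<n. t i)" by linarith
      then have "d ^ m dvd (z j - [:x j:]) * y t"
        unfolding \<open>m = _\<close> power_Suc using d j d_y[of t] by (intro mult_dvd_mono) simp_all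
      then show ?thesis by (simp add: y_Suc dvd_smult)
    qed
    ultimately show "d ^ m dvd (z j - [:x j:]) * f z - taylor n m x e' z"
      by (metis (no_types, lifting) dvd_add dvd_sum)
  qed
qed

text \<open>Functions of a curve stand in for polynomials in \<open>n\<close> variables. Expansions
  are built up by multiplying by one coordinate at a time, so no product of two Taylor polynomials
  has to be truncated.\<close>

definition taylor_stable :: "nat \<Rightarrow> nat \<Rightarrow> (nat \<Rightarrow> 'a) \<Rightarrow> ((nat \<Rightarrow> 'a poly) \<Rightarrow> 'a::comm_ring_1 poly) \<Rightarrow> bool" where
  "taylor_stable n m x f \<longleftrightarrow>
     (\<forall>g. (\<exists>e. has_taylor n m x g e) \<longrightarrow> (\<exists>e. has_taylor n m x (\<lambda>z. f z * g z) e))"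

lemma taylor_stable_1: "taylor_stable n m x (\<lambda>_. 1)"
  by (simp add: taylor_stable_def)

lemma taylor_stable_mult:
  "taylor_stable n m x f \<Longrightarrow> taylor_stable n m x g \<Longrightarrow> taylor_stable n m x (\<lambda>z. f z * g z)"
  unfolding taylor_stable_def by (simp add: mult.assoc)

lemma taylor_stable_power: "taylor_stable n m x f \<Longrightarrow> taylor_stable n m x (\<lambda>z. f z ^ k)"
  by (induction k) (auto intro: taylor_stable_1 taylor_stable_mult)

lemma taylor_stable_prod:
  "(\<And>i. i \<in> A \<Longrightarrow> taylor_stable n m x (f i)) \<Longrightarrow> taylor_stable n m x (\<lambda>z. \<Prod>i\<in>A. f i z)"
  by (induction A rule: infinite_finite_induct) (auto intro: taylor_stable_1 taylor_stable_mult)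

lemma taylor_stable_diff:
  "taylor_stable n m x f \<Longrightarrow> taylor_stable n m x g \<Longrightarrow> taylor_stable n m x (\<lambda>z. f z - g z)"
  unfolding taylor_stable_def left_diff_distrib by (metis has_taylor_diff)

lemma taylor_stable_coord:
  assumes "j < n"
  shows "taylor_stable n m x (\<lambda>z. z j)"
  unfolding taylor_stable_def
proof (intro allI impI)
  fix g assume "\<exists>e. has_taylor n m x g e"
  then obtain e where e: "has_taylor n m x g e" by auto
  obtain e' where "has_taylor n m x (\<lambda>z. (z j - [:x j:]) * g z) e'"
    using has_taylor_mult_shift[OF e assms] by auto
  from has_taylor_diff[OF this has_taylor_smult[OF e, of "- x j"]]
  show "\<exists>e. has_taylor n m x (\<lambda>z. z j * g z) e"
    by (auto simp: algebra_simps)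
qed

lemma has_taylor_basis_poly:
  assumes "n \<ge> 1"
  shows "\<exists>e. has_taylor n m x (basis_poly n t) e"
proof -
  have "taylor_stable n m x (basis_poly n t)"
    unfolding basis_poly_def
    by (intro taylor_stable_mult taylor_stable_power taylor_stable_prod taylor_stable_diff
        taylor_stable_1 taylor_stable_coord) (use assms in auto)
  then show ?thesis using has_taylor_1[of n m x] by (force simp: taylor_stable_def)
qed

section \<open>The multiplicity count\<close>

text \<open>As entries are below \<open>D\<close>, \<open>key\<close> compares first the degrees in
  the coordinates from 1 on, then entry 0. Unless the polynomial of \<open>s\<close> vanishes on the
  curve, \<open>s i \<le> t i\<close> for all \<open>i \<ge> 1\<close>; the key then forces equality
  there and \<open>s 0 > t 0\<close>, hence a larger order.\<close>

lemma eventually_dvd_quot_coeff_basis_poly: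
  assumes p: "prime p" and q: "q = p ^ k"
    and s: "s \<in> simplex n D" and t: "t \<in> simplex n D" and "s \<noteq> t"
    and key: "(\<Sum>i\<in>{1..<n}. t i) * D + t 0 \<le> (\<Sum>i\<in>{1..<n}. s i) * D + s 0"
    and r: "t 0 + excess p n t < q * m" and "n \<ge> 1"
  shows "\<forall>\<^sub>F e in sequentially. int p dvd
    quot_coeff q m (t 0 + excess p n t) e (basis_poly n s (\<lambda>i. monom 1 ((t(0 := 1)) i)))"
proof (cases "\<exists>i\<in>{1..<n}. t i < s i")
  case True
  then obtain i where "i \<in> {1..<n}" "t i < s i" by blast
  then show ?thesis by (simp only: basis_poly_eq_0) (simp add: quot_coeff_def)
next
  case False
  then have le: "s i \<le> t i" if "i \<in> {1..<n}" for i using that by (meson not_less)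
  have eq: "s i = t i" if i: "i \<in> {1..<n}" for i
  proof (rule ccontr)
    assume "s i \<noteq> t i"
    then have "s i < t i" using le[OF i] by simp
    then have "(\<Sum>i\<in>{1..<n}. s i) < (\<Sum>i\<in>{1..<n}. t i)"
      using i le by (intro sum_strict_mono_ex1 bexI[of _ i]) auto
    then have "Suc (\<Sum>i\<in>{1..<n}. s i) * D \<le> (\<Sum>i\<in>{1..<n}. t i) * D"
      by (intro mult_le_mono1) simp
    moreover have "s 0 < D" using simplex_less[OF s, of 0] \<open>n \<ge> 1\<close> by simp
    ultimately show False using key by simp
  qed
  then have "(\<Sum>i\<in>{1..<n}. s i) = (\<Sum>i\<in>{1..<n}. t i)" by (intro sum.cong) auto
  then have "t 0 \<le> s 0" using key by simp
  moreover have "s 0 \<noteq> t 0"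
  proof
    assume "s 0 = t 0"
    then have "s i = t i" if "i \<in> {..<n}" for i using eq[of i] that by (cases "i = 0") auto
    then have "s = t" using s t by (intro PiE_ext[of s "{..<n}" "\<lambda>_. UNIV"]) (auto simp only: simplex_def)
    then show False using \<open>s \<noteq> t\<close> by simp
  qed
  ultimately show ?thesis
    using eq r by (intro dvd_quot_coeff[OF p q _ _ order_mod_basis_poly[OF p]]) auto
qed

lemma basis_curves_independent:
  assumes p: "prime p" and q: "q = p ^ k" and "n \<ge> 1" "l \<ge> 1" and qm: "q * m = p ^ l"
    and D: "(D - 1) * l < p ^ l" and T: "T \<subseteq> simplex n D"
    and dvd: "\<And>t. t \<in> T \<Longrightarrow> (1 - monom 1 q) ^ m dvd
      (\<Sum>s\<in>T. smult (c s) (basis_poly n s (\<lambda>i. monom (zeta q (a t i)) ((t(0 := 1)) i))))"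
  shows "\<forall>t\<in>T. c t = 0"
proof -
  have q0: "q > 0" using p q by (simp add: prime_gt_0_nat)
  have fT: "finite T" using T finite_simplex by (rule finite_subset)
  define key where "key = (\<lambda>t. (\<Sum>i\<in>{1..<n}. t i) * D + t 0)"
  define X where "X = (\<lambda>t s e. quot_coeff q m (t 0 + excess p n t) e
      (basis_poly n s (\<lambda>i. monom (zeta q (a t i)) ((t(0 := 1)) i))))"
  define Y where "Y = (\<lambda>t s e. quot_coeff q m (t 0 + excess p n t) e
      (basis_poly n s (\<lambda>i. monom (1 :: int) ((t(0 := 1)) i))))"
  \<comment> \<open>Each property holds for all large coefficient indices and only finitely many
    columns occur, so one index \<open>e\<close> serves the whole row \<open>t\<close>.\<close>
  have "\<exists>e. (\<Sum>s\<in>T. X t s e * c s) = 0 \<and> \<not> int p dvd Y t t e \<and>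
      (\<forall>s\<in>T. s \<noteq> t \<longrightarrow> key t \<le> key s \<longrightarrow> int p dvd Y t s e)" if t: "t \<in> T" for t
  proof -
    have tD: "t \<in> simplex n D" using t T by auto
    have r: "t 0 + excess p n t < q * m"
      unfolding qm using p \<open>l \<ge> 1\<close> D tD \<open>n \<ge> 1\<close> by (rule excess_less)
    have "\<forall>\<^sub>F e in sequentially. (\<Sum>s\<in>T. c s * X t s e) = 0"
      using quot_coeff_eq_0[OF q0 dvd[OF t]] by (simp add: quot_coeff_sum X_def)
    moreover have "\<forall>\<^sub>F e in sequentially. \<not> int p dvd Y t t e"
      unfolding Y_def by (rule not_dvd_quot_coeff[OF p q r order_mod_basis_poly[OF p, of n t t]]) simp
    moreover have "\<forall>\<^sub>F e in sequentially. \<forall>s\<in>T. s \<noteq> t \<longrightarrow> key t \<le> key s \<longrightarrow> int p dvd Y t s e"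
    proof (intro eventually_ball_finite fT ballI)
      fix s assume s: "s \<in> T"
      show "\<forall>\<^sub>F e in sequentially. s \<noteq> t \<longrightarrow> key t \<le> key s \<longrightarrow> int p dvd Y t s e"
      proof (cases "s \<noteq> t \<and> key t \<le> key s")
        case True
        then have "\<forall>\<^sub>F e in sequentially. int p dvd Y t s e"
          unfolding Y_def key_def using s T
          by (intro eventually_dvd_quot_coeff_basis_poly[OF p q _ tD _ _ r \<open>n \<ge> 1\<close>]) auto
        then show ?thesis by (rule eventually_mono) simp
      qed auto
    qed
    ultimately have "\<forall>\<^sub>F e in sequentially. (\<Sum>s\<in>T. X t s e * c s) = 0 \<and> \<not> int p dvd Y t t e \<and>
        (\<forall>s\<in>T. s \<noteq> t \<longrightarrow> key t \<le> key s \<longrightarrow> int p dvd Y t s e)"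
      by eventually_elim (simp add: mult.commute)
    from eventually_happens'[OF sequentially_bot this] show ?thesis .
  qed
  then obtain e where e: "\<And>t. t \<in> T \<Longrightarrow> (\<Sum>s\<in>T. X t s (e t) * c s) = 0"
    "\<And>t. t \<in> T \<Longrightarrow> \<not> int p dvd Y t t (e t)"
    "\<And>t s. t \<in> T \<Longrightarrow> s \<in> T \<Longrightarrow> s \<noteq> t \<Longrightarrow> key t \<le> key s \<Longrightarrow> int p dvd Y t s (e t)"
    by metis
  show ?thesis
  proof (rule triangular_kernel_trivial[where red = "cyc_red p q" and p = "int p" and key = key and
        X = "\<lambda>t s. X t s (e t)" and Y = "\<lambda>t s. Y t s (e t)"])
    show "cyc_red p q (X t s (e t)) (Y t s (e t))" for t s
      unfolding X_def Y_def by (rule cyc_red_quot_coeff[OF q0])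
    show "int p dvd b" if "cyc_red p q 0 b" for b using p q that by (rule cyc_red_0D)
  qed (use p e fT in \<open>auto intro: cyc_red_diff cyc_red_mult\<close>)
qed

text \<open>Otherwise the unknowns \<open>c (t, x)\<close> outnumber the conditions that all Taylor
  coefficients of degree below \<open>m\<close> vanish at the points of \<open>S\<close>, and a
  nonzero solution contradicts independence over some \<open>x\<close>.\<close>

lemma sum_card_le_card_mult_simplex:
  fixes S :: "(nat \<Rightarrow> int) set" and U :: "(nat \<Rightarrow> nat) \<Rightarrow> 'b set"
  assumes p: "prime p" and q: "q = p ^ k" and "n \<ge> 1" "l \<ge> 1" and qm: "q * m = p ^ l"
    and D: "(D - 1) * l < p ^ l" and "finite S" and U: "\<And>t. finite (U t)"
    and lines: "\<And>t x. t \<in> simplex n D \<Longrightarrow> x \<in> U t \<Longrightarrow> \<exists>a :: nat \<Rightarrow> int. \<forall>j<q. \<exists>s\<in>S. \<pi> s = x \<and>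
      (\<forall>i<n. [s i = a i + int j * int ((t(0 := 1)) i)] (mod int q))"
  shows "(\<Sum>t\<in>simplex n D. card (U t)) \<le> card S * card (simplex n m)"
proof (rule ccontr)
  assume less: "\<not> ?thesis"
  have q0: "q > 0" using p q by (simp add: prime_gt_0_nat)
  define node where "node = (\<lambda>(s :: nat \<Rightarrow> int) i. zeta q (s i))"
  have "\<exists>e. has_taylor n m (node s) (basis_poly n t) e" for s t
    using \<open>n \<ge> 1\<close> by (rule has_taylor_basis_poly)
  then obtain E where E: "\<And>s t. has_taylor n m (node s) (basis_poly n t) (E s t)"
    by metis
  define B where "B = (SIGMA t:simplex n D. U t)"
  \<comment> \<open>A point \<open>s\<close> constrains only the unknowns over its residue
    \<open>\<pi> s\<close>. The conditions are counted as one system, which separates into one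
    polynomial \<open>F\<close> for each \<open>x\<close>.\<close>
  define f where "f = (\<lambda>(s, \<alpha>) (t, x). if x = \<pi> s then E s t \<alpha> else 0)"
  have "finite B" "card B = (\<Sum>t\<in>simplex n D. card (U t))"
    unfolding B_def by (auto simp: finite_simplex U)
  moreover have "finite (S \<times> simplex n m)" "card (S \<times> simplex n m) = card S * card (simplex n m)"
    using \<open>finite S\<close> by (auto simp: finite_simplex card_cartesian_product)
  ultimately obtain c where c: "\<exists>b\<in>B. c b \<noteq> 0"
    "\<And>s \<alpha>. s \<in> S \<Longrightarrow> \<alpha> \<in> simplex n m \<Longrightarrow> (\<Sum>b\<in>B. f (s, \<alpha>) b * c b) = 0"
    using exists_nontrivial_solution[of "S \<times> simplex n m" B f] less by auto
  have "c (t, x) = 0" if "t \<in> simplex n D" "x \<in> U t" for t x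
  proof -
    define T where "T = {t \<in> simplex n D. x \<in> U t}"
    define F where "F = (\<lambda>z. \<Sum>t\<in>T. smult (c (t, x)) (basis_poly n t z))"
    have F_dvd: "d ^ m dvd F z"
      if s: "s \<in> S" "\<pi> s = x" and d: "\<And>i. i < n \<Longrightarrow> d dvd z i - [:node s i:]" for s d z
    proof -
      define e where "e = (\<lambda>\<alpha>. \<Sum>t\<in>T. c (t, x) * E s t \<alpha>)"
      have "e \<alpha> = 0" if "\<alpha> \<in> simplex n m" for \<alpha>
      proof -
        have "0 = (\<Sum>t\<in>simplex n D. \<Sum>y\<in>U t. f (s, \<alpha>) (t, y) * c (t, y))"
          using c(2)[OF s(1) that] by (simp add: B_def sum.Sigma finite_simplex U)
        also have "\<dots> = (\<Sum>t\<in>simplex n D. if x \<in> U t then E s t \<alpha> * c (t, x) else 0)"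
        proof (intro sum.cong refl)
          fix t
          have "(\<Sum>y\<in>U t. f (s, \<alpha>) (t, y) * c (t, y))
              = (\<Sum>y\<in>U t. if y = x then E s t \<alpha> * c (t, x) else 0)"
            by (intro sum.cong) (auto simp: f_def s(2))
          then show "(\<Sum>y\<in>U t. f (s, \<alpha>) (t, y) * c (t, y)) = (if x \<in> U t then E s t \<alpha> * c (t, x) else 0)"
            by (simp add: U)
        qed
        also have "\<dots> = e \<alpha>"
          unfolding e_def T_def by (simp add: sum.inter_filter finite_simplex mult.commute)
        finally show ?thesis by simp
      qed
      then have "taylor n m (node s) e z = 0" by (simp add: taylor_def)
      moreover have "has_taylor n m (node s) F e"
        unfolding F_def e_def by (intro has_taylor_sum_smult E)
      ultimately show ?thesis using d unfolding has_taylor_def by (metis diff_zero)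
    qed
    have "\<forall>t\<in>T. \<exists>a :: nat \<Rightarrow> int. \<forall>j<q. \<exists>s\<in>S. \<pi> s = x \<and>
        (\<forall>i<n. [s i = a i + int j * int ((t(0 := 1)) i)] (mod int q))"
      using lines by (auto simp: T_def)
    then obtain a :: "(nat \<Rightarrow> nat) \<Rightarrow> nat \<Rightarrow> int" where a: "\<forall>t\<in>T. \<forall>j<q. \<exists>s\<in>S. \<pi> s = x \<and>
        (\<forall>i<n. [s i = a t i + int j * int ((t(0 := 1)) i)] (mod int q))"
      by (rule bchoice[THEN exE])
    have "\<forall>t\<in>T. c (t, x) = 0"
    proof (rule basis_curves_independent[OF p q \<open>n \<ge> 1\<close> \<open>l \<ge> 1\<close> qm D, where a = a])
      fix t assume t: "t \<in> T"
      define z where "z = (\<lambda>i. monom (zeta q (a t i)) ((t(0 := 1)) i))"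
      have "(1 - monom 1 q) ^ m dvd F z"
      proof (rule cyclotomic_power_dvd[OF q0])
        fix j assume "j < q"
        with a t obtain s where s: "s \<in> S" "\<pi> s = x"
          "\<And>i. i < n \<Longrightarrow> [s i = a t i + int j * int ((t(0 := 1)) i)] (mod int q)" by blast
        show "[:- zeta q (int j), 1:] ^ m dvd F z"
        proof (rule F_dvd[OF s(1,2)])
          fix i assume i: "i < n"
          \<comment> \<open>The curve of \<open>t\<close> passes through the node of
            \<open>s\<close> at the parameter \<open>w = zeta q j\<close>.\<close>
          have "poly (z i) (zeta q (int j)) = zeta q (a t i + int j * int ((t(0 := 1)) i))"
            unfolding z_def zeta_add zeta_mult_nat by (simp add: poly_monom)
          also have "\<dots> = node s i"
            unfolding node_def using zeta_cong[OF q0 s(3)[OF i]] by simp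
          finally show "[:- zeta q (int j), 1:] dvd z i - [:node s i:]"
            by (simp add: poly_eq_0_iff_dvd[symmetric])
        qed
      qed
      then show "(1 - monom 1 q) ^ m dvd (\<Sum>s\<in>T. smult (c (s, x))
          (basis_poly n s (\<lambda>i. monom (zeta q (a t i)) ((t(0 := 1)) i))))"
        by (simp add: F_def z_def)
    qed (auto simp: T_def)
    then show ?thesis using that by (simp add: T_def)
  qed
  then show False using c(1) by (auto simp: B_def)
qed

section \<open>Kakeya sets\<close>

lemma mod_in_zmod_units_iff:
  assumes "P > 0"
  shows "x mod int P \<in> zmod_units P \<longleftrightarrow> coprime x (int P)"
proof
  assume "x mod int P \<in> zmod_units P"
  then obtain d where "[x mod int P * d = 1] (mod int P)" by (auto simp: zmod_units_def)
  then have "[x * d = 1] (mod int P)" by (simp add: cong_def mod_mult_left_eq)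
  then show "coprime x (int P)" using coprime_iff_invertible_int by blast
next
  assume "coprime x (int P)"
  then obtain d where "[x * d = 1] (mod int P)" using coprime_iff_invertible_int by blast
  then have "[x mod int P * (d mod int P) = 1] (mod int P)"
    by (simp add: cong_def mod_mult_eq)
  then show "x mod int P \<in> zmod_units P"
    using assms unfolding zmod_units_def zmod_def by (auto intro!: bexI[of _ "d mod int P"])
qed

text \<open>A residue modulo a power of \<open>p\<close> with positive exponent is a unit exactly if
  \<open>p\<close> does not divide it.\<close>

lemma direction_vecs_iff:
  "u \<in> direction_vecs N n \<longleftrightarrow> u \<in> zmod_vecs N n \<and> (\<forall>p\<in>prime_factors N. \<exists>j<n. \<not> int p dvd u j)"
proof -
  have "u j mod int (p ^ multiplicity p N) \<in> zmod_units (p ^ multiplicity p N) \<longleftrightarrow> \<not> int p dvd u j"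
    if p: "p \<in> prime_factors N" for p j
  proof -
    have "prime p" "multiplicity p N > 0" using p by (auto simp: prime_factors_multiplicity)
    then show ?thesis
      using prime_imp_coprime[of "int p" "u j"] prime_gt_0_nat[of p]
      by (subst mod_in_zmod_units_iff) (auto simp: coprime_commute coprime_absorb_left)
  qed
  then show ?thesis by (auto simp: direction_vecs_def)
qed

text \<open>The class of \<open>u\<close> gives a line along some representative
  \<open>v = c u\<close>. Replacing the parameter \<open>l\<close> by \<open>l * d\<close>, with
  \<open>d\<close> an inverse of \<open>c\<close>, turns it into a line along \<open>u\<close>
  itself.\<close>

lemma kakeya_set_line:
  assumes S: "kakeya_set N n S" and "N > 0" and u: "u \<in> direction_vecs N n"
  obtains a where "\<And>l. (\<lambda>j\<in>{..<n}. (a j + l * u j) mod int N) \<in> S"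
proof -
  have "unit_multiple_rel N n `` {u} \<in> proj_space N n"
    unfolding proj_space_def using u by (rule quotientI)
  then obtain a v where av: "(u, v) \<in> unit_multiple_rel N n" "line N n a v \<subseteq> S"
    using S unfolding kakeya_set_def line_in_direction_def by fastforce
  then obtain c d where c: "v = vec_smult N n c u" "[c * d = 1] (mod int N)"
    by (auto simp: unit_multiple_rel_def zmod_units_def)
  have "(\<lambda>j\<in>{..<n}. (a j + l * u j) mod int N) \<in> S" for l
  proof -
    define l' where "l' = (l * d) mod int N"
    have "[l' * c = l * d * c] (mod int N)"
      unfolding l'_def by (intro cong_mult cong_refl) (simp add: cong_def)
    moreover have "[l * (c * d) = l * 1] (mod int N)" by (intro cong_mult cong_refl c)
    ultimately have l'c: "[l' * c = l] (mod int N)"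
      by (metis cong_trans mult.assoc mult.commute mult_1_right)
    have "vec_add N n a (vec_smult N n l' v) = (\<lambda>j\<in>{..<n}. (a j + l * u j) mod int N)"
      unfolding vec_add_def
    proof (rule restrict_ext)
      fix j assume "j \<in> {..<n}"
      then have "(a j + vec_smult N n l' v j) mod int N = (a j + l' * c * u j) mod int N"
        by (simp add: vec_smult_def c(1) mod_simps mult.assoc)
      also have "[a j + l' * c * u j = a j + l * u j] (mod int N)"
        by (intro cong_add cong_mult cong_refl l'c)
      then have "(a j + l' * c * u j) mod int N = (a j + l * u j) mod int N" by (simp add: cong_def)
      finally show "(a j + vec_smult N n l' v j) mod int N = (a j + l * u j) mod int N" .
    qed
    moreover have "l' \<in> zmod N" using \<open>N > 0\<close> by (simp add: l'_def zmod_def)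
    ultimately show ?thesis using av(2) unfolding line_def by force
  qed
  then show ?thesis by (rule that)
qed

lemma kakeya_setI:
  assumes "S \<subseteq> zmod_vecs N n" and "N > 0"
    and lines: "\<And>u. u \<in> direction_vecs N n \<Longrightarrow> \<exists>a. \<forall>l. (\<lambda>j\<in>{..<n}. (a j + l * u j) mod int N) \<in> S"
  shows "kakeya_set N n S"
  unfolding kakeya_set_def
proof (intro conjI ballI assms(1))
  fix D assume "D \<in> proj_space N n"
  then obtain u where u: "D = unit_multiple_rel N n `` {u}" "u \<in> direction_vecs N n"
    unfolding proj_space_def by (rule quotientE)
  have u_vec: "u \<in> {..<n} \<rightarrow>\<^sub>E zmod N"
    using u(2) by (simp add: direction_vecs_def zmod_vecs_def)
  \<comment> \<open>The scalar is \<open>1 mod int N\<close> because 1 is not a residue when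
    \<open>N = 1\<close>.\<close>
  have "1 mod int N \<in> zmod_units N" using \<open>N > 0\<close> by (subst mod_in_zmod_units_iff) auto
  moreover have "u = vec_smult N n (1 mod int N) u"
    unfolding vec_smult_def
  proof (rule ext)
    fix j
    show "u j = (\<lambda>j\<in>{..<n}. 1 mod int N * u j mod int N) j"
      using u_vec by (cases "j < n") (auto simp: PiE_iff zmod_def mod_simps extensional_def)
  qed
  ultimately have "(u, u) \<in> unit_multiple_rel N n"
    using u(2) unfolding unit_multiple_rel_def by auto
  then have "u \<in> D" using u(1) by simp
  obtain a where a: "\<And>l. (\<lambda>j\<in>{..<n}. (a j + l * u j) mod int N) \<in> S"
    using lines[OF u(2)] by blast
  define b where "b = (\<lambda>j\<in>{..<n}. a j mod int N)"
  have "b \<in> zmod_vecs N n" using \<open>N > 0\<close> by (auto simp: b_def zmod_vecs_def zmod_def)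
  moreover have "line N n b u \<subseteq> S"
  proof
    fix x assume "x \<in> line N n b u"
    then obtain l where "x = vec_add N n b (vec_smult N n l u)" by (auto simp: line_def)
    also have "\<dots> = (\<lambda>j\<in>{..<n}. (a j + l * u j) mod int N)"
      unfolding vec_add_def by (rule restrict_ext) (simp add: b_def vec_smult_def mod_simps)
    finally show "x \<in> S" using a by simp
  qed
  ultimately show "\<exists>L. line_in_direction N n D L \<and> L \<subseteq> S"
    using \<open>u \<in> D\<close> unfolding line_in_direction_def by blast
qed

section \<open>Splitting off one prime power\<close>

lemma finite_zmod_vecs: "finite (zmod_vecs N n)"
  unfolding zmod_vecs_def zmod_def by (intro finite_PiE) auto

text \<open>By the Chinese remainder theorem \<open>t(0 := 1)\<close> modulo \<open>q\<close> and a
  direction \<open>v\<close> modulo \<open>M\<close> come from one direction \<open>u\<close> modulo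
  \<open>N\<close>. A line along \<open>u\<close> is the product of a line modulo \<open>q\<close>
  and a line modulo \<open>M\<close>, so \<open>U t\<close> contains a line along
  \<open>v\<close>.\<close>

lemma kakeya_set_card_step:
  fixes S :: "(nat \<Rightarrow> int) set"
  assumes p: "prime p" and q: "q = p ^ k" and "k \<ge> 1" and "n \<ge> 1" "l \<ge> 1"
    and qm: "q * m = p ^ l" and D: "(D - 1) * l < p ^ l"
    and N: "N = q * M" and "M > 0" and cop: "coprime q M"
    and S: "kakeya_set N n S" and C: "\<And>S'. kakeya_set M n S' \<Longrightarrow> C \<le> card S'"
  shows "C * card (simplex n D) \<le> card S * card (simplex n m)"
proof -
  have q0: "q > 0" using p q by (simp add: prime_gt_0_nat)
  have "N > 0" using N q0 \<open>M > 0\<close> by simp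
  have cop': "coprime (int q) (int M)" using cop by simp
  have qN: "int q dvd int N" "int M dvd int N" by (auto simp: N)
  define \<pi> where "\<pi> = (\<lambda>(s :: nat \<Rightarrow> int). \<lambda>i\<in>{..<n}. s i mod int M)"
  define U where "U = (\<lambda>t. {x \<in> zmod_vecs M n. \<exists>a :: nat \<Rightarrow> int. \<forall>l. \<exists>s\<in>S. \<pi> s = x \<and>
      (\<forall>i<n. [s i = a i + l * int ((t(0 := 1)) i)] (mod int q))})"
  have "kakeya_set M n (U t)" for t
  proof (rule kakeya_setI)
    fix v assume v: "v \<in> direction_vecs M n"
    have "\<exists>w. [w = int ((t(0 := 1)) i)] (mod int q) \<and> [w = v i] (mod int M)" for i
      by (rule binary_chinese_remainder_int[OF cop'])
    then obtain w where w: "\<And>i. [w i = int ((t(0 := 1)) i)] (mod int q)" "\<And>i. [w i = v i] (mod int M)"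
      by metis
    define u where "u = (\<lambda>i\<in>{..<n}. w i mod int N)"
    have u_w: "[u i = w i] (mod int N)" if "i < n" for i using that by (simp add: u_def cong_def)
    have u1: "[u i = int ((t(0 := 1)) i)] (mod int q)" if "i < n" for i
      using cong_dvd_modulus[OF u_w[OF that] qN(1)] w(1) by (rule cong_trans)
    have u2: "[u i = v i] (mod int M)" if "i < n" for i
      using cong_dvd_modulus[OF u_w[OF that] qN(2)] w(2) by (rule cong_trans)
    have "u \<in> direction_vecs N n"
      unfolding direction_vecs_iff
    proof (intro conjI ballI)
      show "u \<in> zmod_vecs N n" using \<open>N > 0\<close> by (auto simp: u_def zmod_vecs_def zmod_def)
    next
      fix p' assume "p' \<in> prime_factors N"
      then have p': "prime p'" "p' dvd q * M" by (auto simp: N in_prime_factors_iff)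
      then consider "p' dvd q" | "p' dvd M" by (auto simp: prime_dvd_mult_iff)
      then show "\<exists>j<n. \<not> int p' dvd u j"
      proof cases
        case 1
        have "[u 0 = 1] (mod int p')"
          using cong_dvd_modulus[OF u1[of 0], of "int p'"] 1 \<open>n \<ge> 1\<close> by simp
        then have "int p' dvd u 0 \<longleftrightarrow> int p' dvd 1" by (rule cong_dvd_iff)
        then show ?thesis using p'(1) \<open>n \<ge> 1\<close> by (intro exI[of _ 0]) auto
      next
        case 2
        then have "p' \<in> prime_factors M" using p'(1) \<open>M > 0\<close> by (auto simp: in_prime_factors_iff)
        then obtain j where j: "j < n" "\<not> int p' dvd v j" using v by (auto simp: direction_vecs_iff)
        have "[u j = v j] (mod int p')"
          using cong_dvd_modulus[OF u2[OF j(1)], of "int p'"] 2 by simp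
        then have "int p' dvd u j \<longleftrightarrow> int p' dvd v j" by (rule cong_dvd_iff)
        then show ?thesis using j by auto
      qed
    qed
    then obtain a where a: "\<And>l. (\<lambda>j\<in>{..<n}. (a j + l * u j) mod int N) \<in> S"
      using kakeya_set_line[OF S \<open>N > 0\<close>] by blast
    have "(\<lambda>j\<in>{..<n}. (a j + l' * v j) mod int M) \<in> U t" for l'
      unfolding U_def
    proof (intro CollectI conjI exI[of _ a] allI)
      show "(\<lambda>j\<in>{..<n}. (a j + l' * v j) mod int M) \<in> zmod_vecs M n"
        using \<open>M > 0\<close> by (auto simp: zmod_vecs_def zmod_def)
      fix l
      \<comment> \<open>The parameters modulo \<open>q\<close> and modulo \<open>M\<close> can be
        prescribed independently.\<close>
      obtain L where L: "[L = l] (mod int q)" "[L = l'] (mod int M)"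
        using binary_chinese_remainder_int[OF cop'] by blast
      define s where "s = (\<lambda>j\<in>{..<n}. (a j + L * u j) mod int N)"
      have s: "[s i = a i + L * u i] (mod int N)" if "i < n" for i
        using that by (simp add: s_def cong_def)
      have "[s i = a i + l' * v i] (mod int M)" if "i < n" for i
        by (rule cong_trans[OF cong_dvd_modulus[OF s[OF that] qN(2)]])
           (intro cong_add cong_mult cong_refl L u2 that)
      then have "\<pi> s = (\<lambda>j\<in>{..<n}. (a j + l' * v j) mod int M)"
        unfolding \<pi>_def by (intro restrict_ext) (simp add: cong_def)
      moreover have "[s i = a i + l * int ((t(0 := 1)) i)] (mod int q)" if "i < n" for i
        by (rule cong_trans[OF cong_dvd_modulus[OF s[OF that] qN(1)]])
           (intro cong_add cong_mult cong_refl L u1 that)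
      moreover have "s \<in> S" unfolding s_def by (rule a)
      ultimately show "\<exists>s\<in>S. \<pi> s = (\<lambda>j\<in>{..<n}. (a j + l' * v j) mod int M) \<and>
          (\<forall>i<n. [s i = a i + l * int ((t(0 := 1)) i)] (mod int q))" by blast
    qed
    then show "\<exists>a. \<forall>l'. (\<lambda>j\<in>{..<n}. (a j + l' * v j) mod int M) \<in> U t" by blast
  qed (auto simp: U_def \<open>M > 0\<close>)
  then have "C \<le> card (U t)" for t by (rule C)
  then have "(\<Sum>t\<in>simplex n D. C) \<le> (\<Sum>t\<in>simplex n D. card (U t))" by (intro sum_mono)
  also have "\<dots> \<le> card S * card (simplex n m)"
  proof (rule sum_card_le_card_mult_simplex[OF p q \<open>n \<ge> 1\<close> \<open>l \<ge> 1\<close> qm D, where \<pi> = \<pi>])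
    show "finite S" using S finite_zmod_vecs by (auto simp: kakeya_set_def intro: finite_subset)
    show "finite (U t)" for t by (rule finite_subset[OF _ finite_zmod_vecs]) (auto simp: U_def)
    fix t x assume "x \<in> U t"
    then show "\<exists>a :: nat \<Rightarrow> int. \<forall>j<q. \<exists>s\<in>S. \<pi> s = x \<and>
        (\<forall>i<n. [s i = a i + int j * int ((t(0 := 1)) i)] (mod int q))"
      unfolding U_def by blast
  qed
  finally show ?thesis by (simp add: mult.commute)
qed

text \<open>
  The parameter \<open>e\<close> is free: multiplicity \<open>m = p ^ e\<close> is imposed at the points of \<open>S\<close>. The
  theorem takes \<open>e = \<lceil>log\<^sub>p n\<rceil>\<close> for its first bound and \<open>e = 1\<close> for its second.
\<close>

lemma kakeya_set_card_step_real:
  fixes S :: "(nat \<Rightarrow> int) set"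
  assumes p: "prime p" and "k \<ge> 1" "n \<ge> 1"
    and N: "N = p ^ k * M" and "M > 0" and cop: "coprime (p ^ k) M"
    and S: "kakeya_set N n S" and C: "\<And>S'. kakeya_set M n S' \<Longrightarrow> c \<le> real (card S')"
  shows "c * (real p ^ (k + e) / (real (k + e) * (real p ^ e + real n))) ^ n \<le> real (card S)"
proof -
  define l where "l = k + e"
  \<comment> \<open>The largest degree bound with \<open>(D - 1) * l < p ^ l\<close>.\<close>
  define D where "D = nat \<lceil>real (p ^ l) / real l\<rceil>"
  define m where "m = p ^ e"
  \<comment> \<open>Cardinalities are natural numbers, so the real lower bound \<open>c\<close> may
    be rounded up.\<close>
  define c' where "c' = nat \<lceil>c\<rceil>"
  have "l \<ge> 1" using \<open>k \<ge> 1\<close> by (simp add: l_def)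
  have p0: "p > 0" using p by (simp add: prime_gt_0_nat)
  have x0: "real (p ^ l) / real l > 0" using p0 \<open>l \<ge> 1\<close> by simp
  then have D0: "D > 0" unfolding D_def by simp
  have D1: "real (p ^ l) / real l \<le> real D" unfolding D_def by linarith
  have "real (D - 1) < real (p ^ l) / real l"
    using D0 x0 unfolding D_def by (simp add: of_nat_diff) linarith
  then have "real (D - 1) * real l < real (p ^ l)" using \<open>l \<ge> 1\<close> by (simp add: pos_less_divide_eq)
  then have D2: "(D - 1) * l < p ^ l" by (metis of_nat_less_iff of_nat_mult)
  have "c' * card (simplex n D) \<le> card S * card (simplex n m)"
  proof (rule kakeya_set_card_step[OF p refl \<open>k \<ge> 1\<close> \<open>n \<ge> 1\<close> \<open>l \<ge> 1\<close> _ D2 N \<open>M > 0\<close> cop S])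
    show "p ^ k * m = p ^ l" by (simp add: m_def l_def power_add)
    show "c' \<le> card S'" if "kakeya_set M n S'" for S' using C[OF that] unfolding c'_def by linarith
  qed
  then have "real c' * real (card (simplex n D)) \<le> real (card S) * real (card (simplex n m))"
    by (metis of_nat_le_iff of_nat_mult)
  then have "real c' * (fact n * real (card (simplex n D))) \<le> real (card S) * (fact n * real (card (simplex n m)))"
    by (simp add: mult.left_commute)
  moreover have "real D ^ n \<le> fact n * real (card (simplex n D))"
    using fact_binomial_bounds(1)[of "D - 1" n] card_simplex[of n "D - 1"] D0 by simp
  moreover have "fact n * real (card (simplex n m)) \<le> (real p ^ e + real n) ^ n"
  proof -
    have "m > 0" using p0 by (simp add: m_def)
    then have "fact n * real (card (simplex n m)) \<le> real (m - 1 + n) ^ n"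
      using fact_binomial_bounds(2)[of n "m - 1"] card_simplex[of n "m - 1"] by simp
    also have "\<dots> \<le> (real p ^ e + real n) ^ n" using \<open>m > 0\<close> by (intro power_mono) (auto simp: m_def of_nat_diff)
    finally show ?thesis .
  qed
  ultimately have "real c' * real D ^ n \<le> real (card S) * (real p ^ e + real n) ^ n"
    by (meson mult_left_mono of_nat_0_le_iff order_trans)
  moreover have "c * (real p ^ l / real l) ^ n \<le> real c' * real D ^ n"
    using D1 unfolding c'_def by (intro mult_mono power_mono) (auto, linarith)
  ultimately have "c * (real p ^ l / real l) ^ n \<le> real (card S) * (real p ^ e + real n) ^ n" by linarith
  moreover have "(real p ^ e + real n) ^ n > 0" using p0 by (intro zero_less_power add_pos_nonneg) auto
  ultimately have "c * (real p ^ l / real l) ^ n / (real p ^ e + real n) ^ n \<le> real (card S)"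
    by (simp add: pos_divide_le_eq)
  then show ?thesis by (simp add: l_def power_divide power_mult_distrib)
qed

section \<open>Induction over the primes and the explicit bounds\<close>

lemma kakeya_set_card_ge_prod:
  fixes S :: "(nat \<Rightarrow> int) set" and p k e :: "nat \<Rightarrow> nat"
  assumes "n \<ge> 1"
    and "\<And>i. i \<in> {1..r} \<Longrightarrow> prime (p i)"
    and "inj_on p {1..r}"
    and "\<And>i. i \<in> {1..r} \<Longrightarrow> k i \<ge> 1"
    and "kakeya_set (\<Prod>i=1..r. p i ^ k i) n S"
  shows "(\<Prod>i=1..r. (real (p i) ^ (k i + e i) / (real (k i + e i) * (real (p i) ^ e i + real n))) ^ n)
    \<le> real (card S)"
  using assms(2-)
proof (induction r arbitrary: S)
  case 0
  \<comment> \<open>For \<open>r = 0\<close> the modulus is 1 and the bound is the empty product 1.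
    The zero vector is then a direction, so \<open>S\<close> is nonempty.\<close>
  have "(\<lambda>j\<in>{..<n}. 0) \<in> direction_vecs 1 n"
    by (auto simp: direction_vecs_iff zmod_vecs_def zmod_def)
  moreover have "kakeya_set 1 n S" using 0 by simp
  ultimately obtain s where "s \<in> S"
    by (elim kakeya_set_line[of 1 n S "\<lambda>j\<in>{..<n}. 0", rotated 2]) auto
  moreover have "finite S"
    using 0 finite_zmod_vecs by (auto simp: kakeya_set_def intro: finite_subset)
  ultimately have "card S > 0" by (auto simp: card_gt_0_iff)
  then show ?case by simp
next
  case (Suc r)
  define M where "M = (\<Prod>i=1..r. p i ^ k i)"
  have p: "prime (p i)" if "i \<in> {1..Suc r}" for i using that by (rule Suc.prems(1))
  have N: "(\<Prod>i=1..Suc r. p i ^ k i) = p (Suc r) ^ k (Suc r) * M" by (simp add: M_def mult.commute)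
  have "M > 0" unfolding M_def using p by (intro prod_pos) (auto simp: prime_gt_0_nat)
  moreover have "coprime (p (Suc r) ^ k (Suc r)) M"
    unfolding M_def
  proof (rule prod_coprime_right)
    fix i assume i: "i \<in> {1..r}"
    then have "p (Suc r) \<noteq> p i" using inj_onD[OF Suc.prems(2), of "Suc r" i] by auto
    then have "coprime (p (Suc r)) (p i)" using p i by (intro primes_coprime) auto
    then show "coprime (p (Suc r) ^ k (Suc r)) (p i ^ k i)" by simp
  qed
  moreover have "inj_on p {1..r}" using Suc.prems(2) by (rule inj_on_subset) auto
  moreover have "(\<Prod>i=1..r. (real (p i) ^ (k i + e i) / (real (k i + e i) * (real (p i) ^ e i + real n))) ^ n)
      \<le> real (card S')" if "kakeya_set M n S'" for S'
    using that \<open>inj_on p {1..r}\<close> Suc.prems(3) p unfolding M_def by (intro Suc.IH) auto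
  ultimately show ?case
    using kakeya_set_card_step_real[OF p Suc.prems(3) \<open>n \<ge> 1\<close> N _ _ Suc.prems(4), where e = "e (Suc r)"]
    by simp
qed

theorem theorem1p9:
  fixes n N r :: nat and p k :: "nat \<Rightarrow> nat" and S :: "(nat \<Rightarrow> int) set"
  assumes "n \<ge> 1"
    and "\<And>i. i \<in> {1..r} \<Longrightarrow> prime (p i)"
    and "inj_on p {1..r}"
    and "\<And>i. i \<in> {1..r} \<Longrightarrow> k i \<ge> 1"
    and "N = (\<Prod>i=1..r. p i ^ k i)"
    and "kakeya_set N n S"
  shows "real (card S) \<ge>
           (\<Prod>i=1..r. (2 * (real (k i) + real_of_int \<lceil>log (real (p i)) (real n)\<rceil>)) powi (- int n))
             * real N ^ n \<and>
         ((\<forall>i\<in>{1..r}. n \<le> p i) \<longrightarrow>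
           real (card S) \<ge>
             real N ^ n * (\<Prod>i=1..r. (real (k i) + 1) powi (- int n)
                             * (1 + real n / real (p i)) powi (- int n)))"
proof (intro conjI impI)
  have p: "real (p i) > 1" if "i \<in> {1..r}" for i
    using prime_gt_1_nat[OF assms(2)[OF that]] by simp
  have N: "real N ^ n = (\<Prod>i=1..r. (real (p i) ^ k i) ^ n)"
    by (simp add: assms(5) prod_power_distrib)
  note bound = kakeya_set_card_ge_prod[OF assms(1-4) assms(6)[unfolded assms(5)]]
  \<comment> \<open>The least exponent with \<open>n \<le> p ^ e\<close>; then
    \<open>p ^ e + n \<le> 2 * p ^ e\<close>, which accounts for the factor 2.\<close>
  define e where "e = (\<lambda>i. nat \<lceil>log (real (p i)) (real n)\<rceil>)"
  have "(\<Prod>i=1..r. (2 * (real (k i) + real_of_int \<lceil>log (real (p i)) (real n)\<rceil>)) powi (- int n)) * real N ^ n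
      = (\<Prod>i=1..r. (real (p i) ^ k i / (2 * (real (k i) + real_of_int \<lceil>log (real (p i)) (real n)\<rceil>))) ^ n)"
    unfolding N prod.distrib[symmetric]
    by (intro prod.cong) (auto simp: power_int_minus power_divide field_simps)
  also have "\<dots> \<le> (\<Prod>i=1..r. (real (p i) ^ (k i + e i) / (real (k i + e i) * (real (p i) ^ e i + real n))) ^ n)"
  proof (rule prod_mono)
    fix i assume i: "i \<in> {1..r}"
    have log0: "0 \<le> log (real (p i)) (real n)" using p[OF i] \<open>n \<ge> 1\<close> by simp
    then have ei: "real_of_int \<lceil>log (real (p i)) (real n)\<rceil> = real (e i)" by (simp add: e_def)
    have "real n = real (p i) powr log (real (p i)) (real n)" using p[OF i] \<open>n \<ge> 1\<close> by simp
    also have "\<dots> \<le> real (p i) powr real (e i)"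
      using p[OF i] unfolding e_def by (intro powr_mono) linarith+
    also have "\<dots> = real (p i) ^ e i" using p[OF i] by (simp add: powr_realpow)
    finally have n: "real n \<le> real (p i) ^ e i" .
    have pe: "real (p i) ^ e i > 0" using p[OF i] by simp
    have k: "real (k i + e i) > 0" using assms(4)[OF i] by simp
    have "real (p i) ^ k i / (2 * real (k i + e i))
        = real (p i) ^ (k i + e i) / (real (k i + e i) * (2 * real (p i) ^ e i))"
      using pe p[OF i] by (simp add: power_add mult.left_commute[of _ 2])
    also have "\<dots> \<le> real (p i) ^ (k i + e i) / (real (k i + e i) * (real (p i) ^ e i + real n))"
      using pe k n by (intro divide_left_mono mult_left_mono mult_pos_pos add_pos_nonneg) auto
    finally show "0 \<le> (real (p i) ^ k i / (2 * (real (k i) + real_of_int \<lceil>log (real (p i)) (real n)\<rceil>))) ^ n \<and>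
        (real (p i) ^ k i / (2 * (real (k i) + real_of_int \<lceil>log (real (p i)) (real n)\<rceil>))) ^ n
        \<le> (real (p i) ^ (k i + e i) / (real (k i + e i) * (real (p i) ^ e i + real n))) ^ n"
      unfolding ei by (intro conjI power_mono) auto
  qed
  also have "\<dots> \<le> real (card S)" by (rule bound)
  finally show "(\<Prod>i=1..r. (2 * (real (k i) + real_of_int \<lceil>log (real (p i)) (real n)\<rceil>)) powi (- int n))
      * real N ^ n \<le> real (card S)" .
  \<comment> \<open>With \<open>e = 1\<close> each factor is
    \<open>p ^ (k + 1) / ((k + 1) * (p + n))\<close>, and cancelling one \<open>p\<close> turns
    \<open>p + n\<close> into \<open>1 + n / p\<close>.\<close>
  have "real N ^ n * (\<Prod>i=1..r. (real (k i) + 1) powi (- int n) * (1 + real n / real (p i)) powi (- int n))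
      = (\<Prod>i=1..r. (real (p i) ^ (k i + 1) / (real (k i + 1) * (real (p i) ^ 1 + real n))) ^ n)"
    unfolding N prod.distrib[symmetric]
  proof (rule prod.cong)
    fix i assume i: "i \<in> {1..r}"
    have "real (p i) ^ (k i + 1) / (real (k i + 1) * (real (p i) ^ 1 + real n))
        = real (p i) ^ k i * (inverse (real (k i) + 1) * inverse (1 + real n / real (p i)))"
      using p[OF i] by (simp add: field_simps)
    then show "(real (p i) ^ k i) ^ n * ((real (k i) + 1) powi (- int n) * (1 + real n / real (p i)) powi (- int n))
        = (real (p i) ^ (k i + 1) / (real (k i + 1) * (real (p i) ^ 1 + real n))) ^ n"
      by (simp only: power_mult_distrib) (simp add: power_int_minus power_inverse)
  qed simp
  also have "\<dots> \<le> real (card S)" by (rule bound)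
  finally show "real N ^ n * (\<Prod>i=1..r. (real (k i) + 1) powi (- int n)
      * (1 + real n / real (p i)) powi (- int n)) \<le> real (card S)" .
qed

end
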